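(* Let $G$ be an infinite connected unipotent algebraic group over an algebraically closed field $\Bbbk$ of positive characteristic. Then $\delta(G)=\infty$.
   Context: A $G$-module is a finite-dimensional rational representation $V$ of the linear algebraic group $G$ over $\Bbbk$. $\Bbbk[V]\cong S(V^* )$ is the ring of polynomial functions on $V$, with $G$-action $(g\cdot f)(v)=f(g^{-1}v)$ and invariant ring $\Bbbk[V]^G$, graded by degree. $\Bbbk[V]^G_{\le d}$ is the set of invariants of degree at most $d$. For $S\subseteq \Bbbk[V]$, $S_+$ is the set of elements of $S$ with constant term zero. The nullcone $\mathcal{N}_{G,V}\subseteq V$ is the common zero set of $\Bbbk[V]^G_+$. A subset $S\subseteq\Bbbk[V]^G$ is a $\delta$-set if for every $v\in V^G\setminus\mathcal{N}_{G,V}$ there is $f\in S_+$ with $f(v)\neq 0$. Define $\delta(G,V)=\min\{d\ge 0 : \Bbbk[V]^G_{\le d}\text{ is a }\delta\text{-set}\}$ and $\delta(G)=\sup\{\delta(G,V): V\text{ a }G\text{-module}\}$ (equal to $\infty$ if unbounded). *)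

theory Defs
  imports
    "Jordan_Normal_Form.Determinant"
    "HOL-Library.Poly_Mapping"
    "HOL-Library.Extended_Nat"
    "HOL-Analysis.Abstract_Topology"
begin

section \<open>Multivariate polynomials\<close>

abbreviation (input) "keys \<equiv> Poly_Mapping.keys"
abbreviation (input) "lookup \<equiv> Poly_Mapping.lookup"

type_synonym ('x, 'k) mpoly = "('x \<Rightarrow>\<^sub>0 nat) \<Rightarrow>\<^sub>0 'k"

definition mpolys :: "'x set \<Rightarrow> ('x, 'k::comm_ring_1) mpoly set" where
  "mpolys X = {p. \<forall>m\<in>keys p. keys m \<subseteq> X}"

definition meval :: "('x, 'k::comm_ring_1) mpoly \<Rightarrow> ('x \<Rightarrow> 'k) \<Rightarrow> 'k" where
  "meval p a = (\<Sum>m\<in>keys p. lookup p m * (\<Prod>x\<in>keys m. a x ^ lookup m x))"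

text \<open>The zero polynomial gets total degree 0.\<close>

definition total_deg :: "('x, 'k::comm_ring_1) mpoly \<Rightarrow> nat" where
  "total_deg p = Max (insert 0 ((\<lambda>m. \<Sum>x\<in>keys m. lookup m x) ` keys p))"

definition const_coeff :: "('x, 'k::comm_ring_1) mpoly \<Rightarrow> 'k" where
  "const_coeff p = lookup p 0"

lemma meval_superset:
  assumes "finite S" "keys p \<subseteq> S"
  shows "meval p a = (\<Sum>m\<in>S. lookup p m * (\<Prod>x\<in>keys m. a x ^ lookup m x))"
  unfolding meval_def using assms
  by (intro sum.mono_neutral_left) (auto simp: in_keys_iff)

lemma meval_zero [simp]: "meval 0 a = 0"
  by (simp add: meval_def)

lemma meval_one [simp]: "meval 1 a = 1"
  by (simp add: meval_def)

lemma meval_single: "meval (Poly_Mapping.single m c) a = c * (\<Prod>x\<in>keys m. a x ^ lookup m x)"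
  by (simp add: meval_def)

lemma meval_add: "meval (p + q) a = meval p a + meval q a"
proof -
  let ?S = "keys p \<union> keys q"
  have "keys (p + q) \<subseteq> ?S" by (rule Poly_Mapping.keys_add)
  then show ?thesis
    by (simp add: meval_superset[of ?S] lookup_add algebra_simps sum.distrib)
qed

lemma meval_sum: "meval (sum f A) a = (\<Sum>i\<in>A. meval (f i) a)"
  by (induction A rule: infinite_finite_induct) (auto simp: meval_add)

lemma mpoly_sum_monomials:
  "p = (\<Sum>m\<in>keys p. Poly_Mapping.single m (lookup p m))"
proof (rule poly_mapping_eqI)
  fix k
  show "lookup p k = lookup (\<Sum>m\<in>keys p. Poly_Mapping.single m (lookup p m)) k"
    by (cases "k \<in> keys p") (auto simp: lookup_sum lookup_single when_def in_keys_iff sum.delta)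
qed

lemma monomial_eval_add:
  fixes a :: "'x \<Rightarrow> 'k::comm_ring_1"
  shows "(\<Prod>x\<in>keys (m + n). a x ^ lookup (m + n) x) =
    (\<Prod>x\<in>keys m. a x ^ lookup m x) * (\<Prod>x\<in>keys n. a x ^ lookup n x)"
proof -
  have *: "(\<Prod>x\<in>keys r. a x ^ lookup r x) = (\<Prod>x\<in>keys m \<union> keys n. a x ^ lookup r x)"
    if "keys r \<subseteq> keys m \<union> keys n" for r
    using that by (intro prod.mono_neutral_left) (auto simp: in_keys_iff)
  have mn: "keys (m + n) \<subseteq> keys m \<union> keys n" by (rule Poly_Mapping.keys_add)
  show ?thesis
    unfolding *[OF mn] *[OF Un_upper1] *[OF Un_upper2]
    by (simp add: lookup_add power_add prod.distrib)
qed

lemma meval_mult: "meval (p * q) a = meval p a * meval q a"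
proof -
  have "p * q = (\<Sum>m\<in>keys p. Poly_Mapping.single m (lookup p m)) *
      (\<Sum>n\<in>keys q. Poly_Mapping.single n (lookup q n))"
    using mpoly_sum_monomials[of p] mpoly_sum_monomials[of q] by argo
  also have "\<dots> = (\<Sum>m\<in>keys p. \<Sum>n\<in>keys q.
      Poly_Mapping.single (m + n) (lookup p m * lookup q n))"
    unfolding sum_product mult_single ..
  finally have "meval (p * q) a = (\<Sum>m\<in>keys p. \<Sum>n\<in>keys q. lookup p m * lookup q n *
      ((\<Prod>x\<in>keys m. a x ^ lookup m x) * (\<Prod>x\<in>keys n. a x ^ lookup n x)))"
    by (simp only: meval_sum meval_single monomial_eval_add)
  also have "\<dots> = meval p a * meval q a"
    unfolding meval_def sum_product by (intro sum.cong refl) (simp only: mult_ac)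
  finally show ?thesis .
qed

lemma mpolys_mult: "p \<in> mpolys X \<Longrightarrow> q \<in> mpolys X \<Longrightarrow> p * q \<in> mpolys X"
proof -
  assume "p \<in> mpolys X" "q \<in> mpolys X"
  then have "keys (a + b) \<subseteq> X" if "a \<in> keys p" "b \<in> keys q" for a b
    using that Poly_Mapping.keys_add[of a b] unfolding mpolys_def by blast
  then show "p * q \<in> mpolys X"
    using keys_mult[of p q] unfolding mpolys_def by blast
qed

lemma mpolys_one: "1 \<in> mpolys X"
  by (simp add: mpolys_def)


section \<open>Linear algebraic groups\<close>

text \<open>
  A linear algebraic group over \<open>k\<close> is a Zariski closed subgroup of some \<open>GL n\<close>.  The Zariski
  closed subsets of \<open>GL n\<close> are the zero loci of polynomials in the \<open>n\<^sup>2\<close> matrix entries; admitting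
  the inverse of the determinant as a further function gives the same closed sets.
\<close>

definition GL :: "nat \<Rightarrow> 'k::field mat monoid" where
  "GL n = units_of (ring_mat TYPE('k) n ())"

definition zariski_GL :: "nat \<Rightarrow> 'k::field mat topology" where
  "zariski_GL n = topology (\<lambda>U. \<exists>F \<subseteq> mpolys ({..<n} \<times> {..<n}).
     U = {g \<in> carrier (GL n). \<exists>f\<in>F. meval f (($$) g) \<noteq> 0})"

definition linear_algebraic_group :: "nat \<Rightarrow> 'k::field mat set \<Rightarrow> bool" where
  "linear_algebraic_group n G \<longleftrightarrow> subgroup G (GL n) \<and> closedin (zariski_GL n) G"

definition unipotent_group :: "nat \<Rightarrow> 'k::field mat set \<Rightarrow> bool" where
  "unipotent_group n G \<longleftrightarrow> (\<forall>g\<in>G. \<exists>r. (g - 1\<^sub>m n) ^\<^sub>m r = 0\<^sub>m n n)"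

lemma istopology_zariski_GL:
  fixes C :: "'k::field mat set"
  shows "istopology (\<lambda>U. \<exists>F \<subseteq> mpolys ({..<n} \<times> {..<n}).
           U = {g \<in> C. \<exists>f\<in>F. meval f (($$) g) \<noteq> (0::'k)})"
  (is "istopology ?P")
  unfolding istopology_def
proof (intro conjI allI impI)
  fix S T assume "?P S" "?P T"
  then obtain F1 F2
    where F1: "F1 \<subseteq> mpolys ({..<n} \<times> {..<n})" "S = {g \<in> C. \<exists>f\<in>F1. meval f (($$) g) \<noteq> 0}"
      and F2: "F2 \<subseteq> mpolys ({..<n} \<times> {..<n})" "T = {g \<in> C. \<exists>f\<in>F2. meval f (($$) g) \<noteq> 0}"
    by auto
  let ?F = "(\<lambda>(p, q). p * q) ` (F1 \<times> F2)"
  have "?F \<subseteq> mpolys ({..<n} \<times> {..<n})" using F1(1) F2(1) by (auto intro!: mpolys_mult)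
  moreover have "S \<inter> T = {g \<in> C. \<exists>f\<in>?F. meval f (($$) g) \<noteq> 0}"
    by (auto simp: F1(2) F2(2) meval_mult)
  ultimately show "?P (S \<inter> T)" by blast
next
  fix K assume "\<forall>U\<in>K. ?P U"
  then have "\<forall>U\<in>K. \<exists>F. F \<subseteq> mpolys ({..<n} \<times> {..<n}) \<and>
      U = {g \<in> C. \<exists>f\<in>F. meval f (($$) g) \<noteq> 0}" by simp
  from bchoice[OF this] obtain F where F: "\<forall>U\<in>K. F U \<subseteq> mpolys ({..<n} \<times> {..<n}) \<and>
      U = {g \<in> C. \<exists>f\<in>F U. meval f (($$) g) \<noteq> 0}" by (rule exE)
  then have "(\<Union>U\<in>K. F U) \<subseteq> mpolys ({..<n} \<times> {..<n})" by (simp add: UN_subset_iff)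
  moreover have "\<Union>K = {g \<in> C. \<exists>f\<in>(\<Union>U\<in>K. F U). meval f (($$) g) \<noteq> 0}"
proof -
    have "\<Union>K = (\<Union>U\<in>K. {g \<in> C. \<exists>f\<in>F U. meval f (($$) g) \<noteq> 0})"
      using F by (metis (mono_tags, lifting) SUP_cong image_ident)
    also have "\<dots> = {g \<in> C. \<exists>f\<in>(\<Union>U\<in>K. F U). meval f (($$) g) \<noteq> 0}" by blast
    finally show ?thesis .
  qed
  ultimately show "?P (\<Union>K)" by blast
qed

lemma openin_zariski_GL:
  "openin (zariski_GL n) U \<longleftrightarrow> (\<exists>F \<subseteq> mpolys ({..<n} \<times> {..<n}).
     U = {g \<in> carrier (GL n). \<exists>f\<in>F. meval f (($$) g) \<noteq> 0})"
  unfolding zariski_GL_def topology_inverse'[OF istopology_zariski_GL] ..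

lemma topspace_zariski_GL: "topspace (zariski_GL n) = carrier (GL n)"
proof
  show "topspace (zariski_GL n) \<subseteq> carrier (GL n)"
    using openin_topspace[of "zariski_GL n"] unfolding openin_zariski_GL by blast
  have "openin (zariski_GL n) (carrier (GL n))"
    unfolding openin_zariski_GL by (rule exI[of _ "{1}"]) (auto simp: mpolys_one)
  then show "carrier (GL n) \<subseteq> topspace (zariski_GL n)" by (rule openin_subset)
qed

lemma closedin_zariski_GL:
  "closedin (zariski_GL n) Z \<longleftrightarrow> (\<exists>F \<subseteq> mpolys ({..<n} \<times> {..<n}).
     Z = {g \<in> carrier (GL n). \<forall>f\<in>F. meval f (($$) g) = 0})"
  (is "_ \<longleftrightarrow> (\<exists>F \<subseteq> ?M. Z = ?V F)")
proof
  assume "closedin (zariski_GL n) Z"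
  then obtain F where F: "F \<subseteq> ?M" "Z \<subseteq> carrier (GL n)"
      "carrier (GL n) - Z = {g \<in> carrier (GL n). \<exists>f\<in>F. meval f (($$) g) \<noteq> 0}"
    unfolding closedin_def openin_zariski_GL topspace_zariski_GL by blast
  have "Z = carrier (GL n) - (carrier (GL n) - Z)" using F(2) by blast
  also have "\<dots> = ?V F" unfolding F(3) by blast
  finally show "\<exists>F \<subseteq> ?M. Z = ?V F" using F(1) by blast
next
  assume "\<exists>F \<subseteq> ?M. Z = ?V F"
  then obtain F where "F \<subseteq> ?M" "Z = ?V F" by blast
  moreover from this have "carrier (GL n) - Z =
      {g \<in> carrier (GL n). \<exists>f\<in>F. meval f (($$) g) \<noteq> 0}" by blast
  ultimately show "closedin (zariski_GL n) Z"
    unfolding closedin_def openin_zariski_GL topspace_zariski_GL by blast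
qed


section \<open>Modules, invariants and the nullcone\<close>

text \<open>
  After a choice of basis, a \<open>G\<close>-module is a rational representation
  \<open>\<rho> : G \<rightarrow> GL m\<close> on \<open>V = k\<^sup>m\<close>.  The regular functions on a closed subset of
  \<open>GL n\<close> are the restrictions of elements of the coordinate ring of \<open>GL n\<close>, which is the polynomial
  ring in the matrix entries localised at the determinant.
\<close>

definition regular_function :: "nat \<Rightarrow> 'k::field mat set \<Rightarrow> ('k mat \<Rightarrow> 'k) \<Rightarrow> bool" where
  "regular_function n G \<phi> \<longleftrightarrow>
     (\<exists>p \<in> mpolys ({..<n} \<times> {..<n}). \<exists>r. \<forall>g\<in>G. \<phi> g = meval p (($$) g) / det g ^ r)"

definition G_module :: "nat \<Rightarrow> 'k::field mat set \<Rightarrow> nat \<Rightarrow> ('k mat \<Rightarrow> 'k mat) \<Rightarrow> bool" where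
  "G_module n G m \<rho> \<longleftrightarrow>
     \<rho> \<in> hom (GL n\<lparr>carrier := G\<rparr>) (GL m) \<and>
     (\<forall>i<m. \<forall>j<m. regular_function n G (\<lambda>g. \<rho> g $$ (i, j)))"

text \<open>
  \<open>k[V]\<close> is \<open>mpolys {..<m}\<close>, the variable \<open>i\<close> being the \<open>i\<close>-th coordinate function.  For infinite
  \<open>k\<close> a polynomial is determined by its values, so invariance may be tested on the points of \<open>V\<close>.
\<close>

definition invariants ::
    "nat \<Rightarrow> 'k::field mat set \<Rightarrow> nat \<Rightarrow> ('k mat \<Rightarrow> 'k mat) \<Rightarrow> (nat, 'k) mpoly set" where
  "invariants n G m \<rho> = {f \<in> mpolys {..<m}. \<forall>g\<in>G. \<forall>v\<in>carrier_vec m.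
     meval f (($) (\<rho> (inv\<^bsub>GL n\<^esub> g) *\<^sub>v v)) = meval f (($) v)}"

definition invariants_upto ::
    "nat \<Rightarrow> 'k::field mat set \<Rightarrow> nat \<Rightarrow> ('k mat \<Rightarrow> 'k mat) \<Rightarrow> nat \<Rightarrow> (nat, 'k) mpoly set" where
  "invariants_upto n G m \<rho> d = {f \<in> invariants n G m \<rho>. total_deg f \<le> d}"

definition plus_part :: "(nat, 'k::field) mpoly set \<Rightarrow> (nat, 'k) mpoly set" where
  "plus_part S = {f \<in> S. const_coeff f = 0}"

definition fixed_points ::
    "'k::field mat set \<Rightarrow> nat \<Rightarrow> ('k mat \<Rightarrow> 'k mat) \<Rightarrow> 'k vec set" where
  "fixed_points G m \<rho> = {v \<in> carrier_vec m. \<forall>g\<in>G. \<rho> g *\<^sub>v v = v}"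

definition nullcone ::
    "nat \<Rightarrow> 'k::field mat set \<Rightarrow> nat \<Rightarrow> ('k mat \<Rightarrow> 'k mat) \<Rightarrow> 'k vec set" where
  "nullcone n G m \<rho> =
     {v \<in> carrier_vec m. \<forall>f\<in>plus_part (invariants n G m \<rho>). meval f (($) v) = 0}"


section \<open>The delta number\<close>

definition delta_set ::
    "nat \<Rightarrow> 'k::field mat set \<Rightarrow> nat \<Rightarrow> ('k mat \<Rightarrow> 'k mat) \<Rightarrow> (nat, 'k) mpoly set \<Rightarrow> bool" where
  "delta_set n G m \<rho> S \<longleftrightarrow> S \<subseteq> invariants n G m \<rho> \<and>
     (\<forall>v \<in> fixed_points G m \<rho> - nullcone n G m \<rho>. \<exists>f\<in>plus_part S. meval f (($) v) \<noteq> 0)"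

text \<open>
  The minimum is attained: by Hilbert's basis theorem the nullcone is already cut out by finitely
  many invariants.
\<close>

definition delta_module ::
    "nat \<Rightarrow> 'k::field mat set \<Rightarrow> nat \<Rightarrow> ('k mat \<Rightarrow> 'k mat) \<Rightarrow> nat" where
  "delta_module n G m \<rho> = (LEAST d. delta_set n G m \<rho> (invariants_upto n G m \<rho> d))"

definition delta_group :: "nat \<Rightarrow> 'k::field mat set \<Rightarrow> enat" where
  "delta_group n G = Sup {enat (delta_module n G m \<rho>) | m \<rho>. G_module n G m \<rho>}"

end

theory Submission
  imports Defs "Jordan_Normal_Form.Char_Poly" "HOL-Computational_Algebra.Primes"
begin

text \<open>
  Put \<open>p = char k\<close>.  By Kolchin's theorem applied to subquotients of \<open>k\<^sup>n\<close> there is a vector \<open>v\<close>, not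
  fixed by \<open>G\<close>, such that all \<open>g v - v\<close> are fixed by \<open>G\<close>.  A suitable coordinate of \<open>g v - v\<close> is then a
  nonzero regular homomorphism \<open>\<phi>\<close> from \<open>G\<close> to the additive group of \<open>k\<close>; its image is infinite since
  \<open>G\<close> is connected.  For \<open>q = p\<^sup>r\<close> let \<open>G\<close> act on \<open>k\<^sup>3\<close> by
  \<open>(a, z, b) \<mapsto> (a, z + \<phi>(g) a, b + \<phi>(g)\<^sup>q a)\<close>.  Then \<open>z\<^sup>q - a\<^bsup>q - 1\<^esup> b\<close> is an invariant that is nonzero at
  the fixed point \<open>(0, 1, 0)\<close>, whereas every invariant \<open>f\<close> of degree less than \<open>q\<close> without constant term
  vanishes there: for \<open>s \<noteq> 0\<close> the function \<open>z \<mapsto> f (s, z, 0)\<close> is a polynomial in \<open>z\<^sup>q\<close>, so it is constant, and one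
  lets \<open>s\<close> tend to \<open>0\<close> algebraically.
\<close>

section \<open>Injective matrices and rank factorization\<close>

definition vec_subspace :: "nat \<Rightarrow> 'k::field vec set \<Rightarrow> bool" where
  "vec_subspace r W \<longleftrightarrow> W \<subseteq> carrier_vec r \<and> 0\<^sub>v r \<in> W \<and>
     (\<forall>u\<in>W. \<forall>v\<in>W. u + v \<in> W) \<and> (\<forall>c. \<forall>v\<in>W. c \<cdot>\<^sub>v v \<in> W)"

definition mat_inj :: "'k::field mat \<Rightarrow> bool" where
  "mat_inj P \<longleftrightarrow> (\<forall>v\<in>carrier_vec (dim_col P). P *\<^sub>v v = 0\<^sub>v (dim_row P) \<longrightarrow> v = 0\<^sub>v (dim_col P))"

definition mat_range :: "'k::field mat \<Rightarrow> 'k vec set" where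
  "mat_range P = (*\<^sub>v) P ` carrier_vec (dim_col P)"

lemma mat_injD:
  assumes "mat_inj P" "P \<in> carrier_mat r s" "v \<in> carrier_vec s" "P *\<^sub>v v = 0\<^sub>v r"
  shows "v = 0\<^sub>v s"
  using assms unfolding mat_inj_def by auto

lemma mat_inj_cancel_vec:
  assumes P: "mat_inj P" "P \<in> carrier_mat r s" and "u \<in> carrier_vec s" "v \<in> carrier_vec s"
    and eq: "P *\<^sub>v u = P *\<^sub>v v"
  shows "u = v"
proof -
  have "P *\<^sub>v (u - v) = 0\<^sub>v r"
    using assms by (simp add: mult_minus_distrib_mat_vec)
  then have "u - v = 0\<^sub>v s"
    using mat_injD[OF P] assms by auto
  then have *: "(u - v) $ i = 0" if "i < s" for i
    using that by simp
  show ?thesis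
    using assms * by (intro eq_vecI) auto
qed

lemma mult_mat_unit_vec:
  "(A :: 'k::semiring_1 mat) \<in> carrier_mat r s \<Longrightarrow> j < s \<Longrightarrow> A *\<^sub>v unit_vec s j = col A j"
  by (intro eq_vecI) (auto simp: scalar_prod_right_unit[of _ s])

lemma mat_eq_if_mult_vec_eq:
  fixes A B :: "'k::field mat"
  assumes A: "A \<in> carrier_mat r s" and B: "B \<in> carrier_mat r s"
    and eq: "\<And>v. v \<in> carrier_vec s \<Longrightarrow> A *\<^sub>v v = B *\<^sub>v v"
  shows "A = B"
proof (rule mat_col_eqI)
  fix j assume "j < dim_col B"
  then have "j < s" using B by simp
  then have "A *\<^sub>v unit_vec s j = B *\<^sub>v unit_vec s j" by (intro eq) simp
  then show "col A j = col B j"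
    using A B \<open>j < s\<close> by (simp add: mult_mat_unit_vec)
qed (use A B in auto)

lemma mat_inj_cancel:
  assumes P: "mat_inj P" "P \<in> carrier_mat r s"
    and A: "A \<in> carrier_mat s t" and B: "B \<in> carrier_mat s t" and eq: "P * A = P * B"
  shows "A = B"
proof (rule mat_eq_if_mult_vec_eq[OF A B])
  fix v :: "'a vec" assume v: "v \<in> carrier_vec t"
  have "P *\<^sub>v (A *\<^sub>v v) = P *\<^sub>v (B *\<^sub>v v)"
    using eq assoc_mult_mat_vec[OF P(2) A v] assoc_mult_mat_vec[OF P(2) B v] by simp
  then show "A *\<^sub>v v = B *\<^sub>v v"
    using mat_inj_cancel_vec[OF P] A B v by auto
qed

lemma mat_inj_mult:
  assumes P: "mat_inj P" "P \<in> carrier_mat r s" and Q: "mat_inj Q" "Q \<in> carrier_mat s t"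
  shows "mat_inj (P * Q)"
  unfolding mat_inj_def
proof (intro ballI impI)
  fix v assume v: "v \<in> carrier_vec (dim_col (P * Q))" and "P * Q *\<^sub>v v = 0\<^sub>v (dim_row (P * Q))"
  then have "P *\<^sub>v (Q *\<^sub>v v) = 0\<^sub>v r"
    using P Q by (simp add: assoc_mult_mat_vec[of P r s Q t v])
  then have "Q *\<^sub>v v = 0\<^sub>v s"
    using mat_injD[OF P] v Q by auto
  then show "v = 0\<^sub>v (dim_col (P * Q))"
    using mat_injD[OF Q] v Q by auto
qed

lemma mat_inj_dim_le:
  assumes P: "mat_inj P" "P \<in> carrier_mat r s"
  shows "s \<le> r"
proof (rule ccontr)
  assume "\<not> s \<le> r"
  then have rs: "r < s" by simp
  define M where "M = mat s s (\<lambda>(i,j). if i < r then P $$ (i,j) else 0)"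
  have M: "M \<in> carrier_mat s s" by (simp add: M_def)
  have "det M = 0"
  proof (rule ccontr)
    assume "det M \<noteq> 0"
    from det_non_zero_imp_unit[OF M this, unfolded Units_def, of "()"]
    obtain B where B: "B \<in> carrier_mat s s" "M * B = 1\<^sub>m s"
      by (auto simp: ring_mat_def)
    have "(M * B) $$ (r, r) = 0"
      using rs B(1) M by (simp add: scalar_prod_def M_def)
    then show False unfolding B(2) using rs by simp
  qed
  then obtain v where v: "v \<in> carrier_vec s" "v \<noteq> 0\<^sub>v s" "M *\<^sub>v v = 0\<^sub>v s"
    using det_0_iff_vec_prod_zero_field[OF M] by blast
  have "P *\<^sub>v v = 0\<^sub>v r"
  proof (rule eq_vecI)
    fix i assume i: "i < dim_vec (0\<^sub>v r :: 'a vec)"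
    have "(M *\<^sub>v v) $ i = 0" unfolding v(3) using rs i by simp
    then show "(P *\<^sub>v v) $ i = 0\<^sub>v r $ i"
      using i rs P v(1) by (simp add: M_def scalar_prod_def)
  qed (use P in auto)
  then show False using mat_injD[OF P] v by blast
qed

lemma mat_inj_square_range:
  assumes P: "mat_inj P" "P \<in> carrier_mat r r"
  shows "mat_range P = carrier_vec r"
proof -
  have "det P \<noteq> 0"
    using det_0_iff_vec_prod_zero_field[OF P(2)] mat_injD[OF P] by blast
  from det_non_zero_imp_unit[OF P(2) this, unfolded Units_def, of "()"]
  obtain B where B: "B \<in> carrier_mat r r" "P * B = 1\<^sub>m r"
    by (auto simp: ring_mat_def)
  have "w \<in> mat_range P" if w: "w \<in> carrier_vec r" for w
  proof -
    have "P *\<^sub>v (B *\<^sub>v w) = w"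
      using assoc_mult_mat_vec[OF P(2) B(1) w] B w by simp
    then show ?thesis
      unfolding mat_range_def using P B w by (intro image_eqI[of _ _ "B *\<^sub>v w"]) auto
  qed
  then show ?thesis using P by (auto simp: mat_range_def)
qed

lemma vec_subspace_mat_range:
  assumes P: "P \<in> carrier_mat r s"
  shows "vec_subspace r (mat_range P)"
  unfolding vec_subspace_def mat_range_def
proof (intro conjI ballI allI)
  show "0\<^sub>v r \<in> (*\<^sub>v) P ` carrier_vec (dim_col P)"
    using P by (intro image_eqI[of _ _ "0\<^sub>v s"]) auto
next
  fix u v assume "u \<in> (*\<^sub>v) P ` carrier_vec (dim_col P)" "v \<in> (*\<^sub>v) P ` carrier_vec (dim_col P)"
  then obtain u' v' where "u' \<in> carrier_vec s" "v' \<in> carrier_vec s" "u = P *\<^sub>v u'" "v = P *\<^sub>v v'"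
    using P by auto
  then show "u + v \<in> (*\<^sub>v) P ` carrier_vec (dim_col P)"
    using P by (intro image_eqI[of _ _ "u' + v'"]) (auto simp: mult_add_distrib_mat_vec)
next
  fix c v assume "v \<in> (*\<^sub>v) P ` carrier_vec (dim_col P)"
  then obtain v' where "v' \<in> carrier_vec s" "v = P *\<^sub>v v'"
    using P by auto
  then show "c \<cdot>\<^sub>v v \<in> (*\<^sub>v) P ` carrier_vec (dim_col P)"
    using P by (intro image_eqI[of _ _ "c \<cdot>\<^sub>v v'"]) (auto simp: mult_mat_vec)
qed (use P in auto)

lemma mult_append_col:
  fixes P :: "'k::comm_ring_1 mat"
  assumes P: "P \<in> carrier_mat r s" and w: "w \<in> carrier_vec r" and v: "v \<in> carrier_vec (Suc s)"
  shows "mat r (Suc s) (\<lambda>(i,j). if j < s then P $$ (i,j) else w $ i) *\<^sub>v v =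
    P *\<^sub>v vec s (($) v) + v $ s \<cdot>\<^sub>v w"
  using assms by (intro eq_vecI) (auto simp: scalar_prod_def row_def mult.commute[of "v $ s"])

lemma vec_subspace_basis:
  assumes W: "vec_subspace r W"
  obtains s P where "P \<in> carrier_mat r s" "mat_inj P" "W = mat_range P" "s \<le> r"
    "s = r \<longrightarrow> W = carrier_vec r"
proof -
  define Q where "Q s \<longleftrightarrow> (\<exists>P\<in>carrier_mat r s. mat_inj P \<and> mat_range P \<subseteq> W)" for s
  have "mat_inj (0\<^sub>m r 0 :: 'a mat)" by (auto simp: mat_inj_def)
  moreover have "(0\<^sub>m r 0 :: 'a mat) *\<^sub>v v = 0\<^sub>v r" if "v \<in> carrier_vec 0" for v
    using that by (intro eq_vecI) (auto simp: scalar_prod_def)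
  then have "mat_range (0\<^sub>m r 0 :: 'a mat) \<subseteq> W"
    using W by (auto simp: mat_range_def vec_subspace_def)
  ultimately have Q0: "Q 0" unfolding Q_def by (intro bexI[of _ "0\<^sub>m r 0"]) auto
  have Q_le: "s \<le> r" if "Q s" for s
    using that mat_inj_dim_le unfolding Q_def by blast
  define s where "s = (GREATEST s. Q s)"
  have "Q s" unfolding s_def using Q0 Q_le by (rule GreatestI_nat)
  have s_max: "t \<le> s" if "Q t" for t
    unfolding s_def using that Q_le by (rule Greatest_le_nat)
  obtain P where P: "P \<in> carrier_mat r s" "mat_inj P" "mat_range P \<subseteq> W"
    using \<open>Q s\<close> unfolding Q_def by blast
  have "w \<in> mat_range P" if w: "w \<in> W" for w
  proof (rule ccontr)
    assume nw: "w \<notin> mat_range P"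
    define P' where "P' = mat r (Suc s) (\<lambda>(i,j). if j < s then P $$ (i,j) else w $ i)"
    have P': "P' \<in> carrier_mat r (Suc s)" by (simp add: P'_def)
    have wr: "w \<in> carrier_vec r" using W w by (auto simp: vec_subspace_def)
    have mult: "P' *\<^sub>v v = P *\<^sub>v vec s (($) v) + v $ s \<cdot>\<^sub>v w" if "v \<in> carrier_vec (Suc s)" for v
      unfolding P'_def using P(1) wr that by (rule mult_append_col)
    have range: "P *\<^sub>v u \<in> mat_range P" if "u \<in> carrier_vec s" for u
      using that P by (auto simp: mat_range_def)
    have "mat_inj P'"
      unfolding mat_inj_def
    proof (intro ballI impI)
      fix v assume "v \<in> carrier_vec (dim_col P')" "P' *\<^sub>v v = 0\<^sub>v (dim_row P')"
      then have v: "v \<in> carrier_vec (Suc s)" and eq: "P *\<^sub>v vec s (($) v) + v $ s \<cdot>\<^sub>v w = 0\<^sub>v r"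
        using P' mult by auto
      have *: "(P *\<^sub>v vec s (($) v)) $ i + v $ s * w $ i = 0" if "i < r" for i
      proof -
        have "(P *\<^sub>v vec s (($) v) + v $ s \<cdot>\<^sub>v w) $ i = 0" using that by (simp add: eq)
        then show ?thesis using that wr P by simp
      qed
      have "v $ s = 0"
      proof (rule ccontr)
        assume vs: "v $ s \<noteq> 0"
        have "w = P *\<^sub>v ((- inverse (v $ s)) \<cdot>\<^sub>v vec s (($) v))"
        proof (rule eq_vecI)
          fix i assume "i < dim_vec (P *\<^sub>v ((- inverse (v $ s)) \<cdot>\<^sub>v vec s (($) v)))"
          then have i: "i < r" using P by simp
          have "w $ i = - inverse (v $ s) * (P *\<^sub>v vec s (($) v)) $ i"
            using *[OF i] vs by (simp add: field_simps eq_neg_iff_add_eq_0)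
          also have "\<dots> = (P *\<^sub>v ((- inverse (v $ s)) \<cdot>\<^sub>v vec s (($) v))) $ i"
            using i P by (simp add: mult_mat_vec[OF P(1)])
          finally show "w $ i = (P *\<^sub>v ((- inverse (v $ s)) \<cdot>\<^sub>v vec s (($) v))) $ i" .
        qed (use wr P in auto)
        then show False using nw range by (metis smult_carrier_vec vec_carrier)
      qed
      then have "P *\<^sub>v vec s (($) v) = 0\<^sub>v r"
        using * P by (intro eq_vecI) auto
      then have "vec s (($) v) = 0\<^sub>v s"
        using mat_injD[OF P(2,1)] by simp
      then have "v $ i = 0" if "i < s" for i
        using that by (metis index_vec index_zero_vec(1))
      then show "v = 0\<^sub>v (dim_col P')"
        using \<open>v $ s = 0\<close> v P' by (intro eq_vecI) (auto simp: less_Suc_eq)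
    qed
    moreover have "mat_range P' \<subseteq> W"
    proof
      fix x assume "x \<in> mat_range P'"
      then obtain v where v: "v \<in> carrier_vec (Suc s)" "x = P' *\<^sub>v v"
        using P' by (auto simp: mat_range_def)
      have "P *\<^sub>v vec s (($) v) \<in> W" using range P(3) by auto
      moreover have "v $ s \<cdot>\<^sub>v w \<in> W" using W w by (auto simp: vec_subspace_def)
      ultimately show "x \<in> W" using W v mult by (simp add: vec_subspace_def)
    qed
    ultimately have "Q (Suc s)" unfolding Q_def using P' by blast
    then show False using s_max by fastforce
  qed
  then have eq: "W = mat_range P" using P by blast
  show thesis
  proof (rule that[OF P(1,2) eq Q_le[OF \<open>Q s\<close>]])
    show "s = r \<longrightarrow> W = carrier_vec r" using mat_inj_square_range[of P r] P(1,2) eq by auto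
  qed
qed

lemma mat_factor_through:
  fixes P :: "'k::field mat"
  assumes P: "P \<in> carrier_mat m s" and M: "M \<in> carrier_mat m n" and range: "mat_range M \<subseteq> mat_range P"
  obtains Y where "Y \<in> carrier_mat s n" "M = P * Y"
proof -
  have "\<exists>y\<in>carrier_vec s. col M j = P *\<^sub>v y" if "j < n" for j
  proof -
    have "col M j \<in> mat_range M"
      unfolding mat_range_def using M that
      by (intro image_eqI[of _ _ "unit_vec n j"]) (auto simp: mult_mat_unit_vec)
    then show ?thesis using range P by (auto simp: mat_range_def)
  qed
  then obtain y where y: "\<And>j. j < n \<Longrightarrow> y j \<in> carrier_vec s" "\<And>j. j < n \<Longrightarrow> col M j = P *\<^sub>v y j"
    by metis
  define Y where "Y = mat s n (\<lambda>(i,j). y j $ i)"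
  have Y: "Y \<in> carrier_mat s n" by (simp add: Y_def)
  have colY: "col Y j = y j" if "j < n" for j
    using that y(1)[OF that] by (intro eq_vecI) (auto simp: Y_def)
  have MPY: "M = P * Y"
  proof (rule mat_col_eqI)
    fix j assume "j < dim_col (P * Y)"
    then have "j < n" using Y by simp
    then show "col M j = col (P * Y) j"
      unfolding col_mult2[OF P Y \<open>j < n\<close>] colY[OF \<open>j < n\<close>] using y(2) by simp
  qed (use M P Y in auto)
  show thesis by (rule that[OF Y MPY])
qed

text \<open>The factor \<open>Y\<close> is surjective because \<open>M\<close> and \<open>X\<close> have the same range.\<close>

lemma rank_factorization:
  fixes M :: "'k::field mat"
  assumes M: "M \<in> carrier_mat m n"
  obtains s X Y where "X \<in> carrier_mat m s" "mat_inj X" "Y \<in> carrier_mat s n"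
    "mat_range Y = carrier_vec s" "M = X * Y" "s \<le> m"
    "s = m \<longrightarrow> mat_range M = carrier_vec m"
proof -
  obtain s X where X: "X \<in> carrier_mat m s" "mat_inj X" "mat_range M = mat_range X" "s \<le> m"
    "s = m \<longrightarrow> mat_range M = carrier_vec m"
    by (rule vec_subspace_basis[OF vec_subspace_mat_range[OF M]])
  obtain Y where Y: "Y \<in> carrier_mat s n" and MXY: "M = X * Y"
    using mat_factor_through[OF X(1) M] X(3) by auto
  have "w \<in> mat_range Y" if w: "w \<in> carrier_vec s" for w
  proof -
    have "X *\<^sub>v w \<in> mat_range M" using w X by (auto simp: mat_range_def)
    then obtain v where v: "v \<in> carrier_vec n" "X *\<^sub>v w = M *\<^sub>v v"
      using M by (auto simp: mat_range_def)
    then have "X *\<^sub>v w = X *\<^sub>v (Y *\<^sub>v v)" using MXY X Y by simp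
    then have "w = Y *\<^sub>v v"
      using mat_inj_cancel_vec[OF X(2,1)] w v Y by auto
    then show ?thesis using v Y by (auto simp: mat_range_def)
  qed
  then have "mat_range Y = carrier_vec s" using Y by (auto simp: mat_range_def)
  then show thesis using that[OF X(1,2) Y _ MXY X(4,5)] by simp
qed

lemma mat_surj_mult:
  assumes Y: "Y \<in> carrier_mat s n" "mat_range Y = carrier_vec s"
    and Z: "Z \<in> carrier_mat t s" "mat_range Z = carrier_vec t"
  shows "mat_range (Z * Y) = carrier_vec t"
proof -
  have "w \<in> mat_range (Z * Y)" if w: "w \<in> carrier_vec t" for w
  proof -
    obtain u where u: "u \<in> carrier_vec s" "w = Z *\<^sub>v u" using w Z by (auto simp: mat_range_def)
    then obtain v where v: "v \<in> carrier_vec n" "u = Y *\<^sub>v v" using Y by (auto simp: mat_range_def)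
    have "w = (Z * Y) *\<^sub>v v" using assoc_mult_mat_vec[OF Z(1) Y(1) v(1)] u v by simp
    then show ?thesis using v Y by (auto simp: mat_range_def)
  qed
  moreover have "(Z * Y) *\<^sub>v v \<in> carrier_vec t" if "v \<in> carrier_vec n" for v
    using mult_mat_vec_carrier[OF mult_carrier_mat[OF Z(1) Y(1)] that] .
  ultimately show ?thesis using Y(1) by (auto simp: mat_range_def)
qed

lemma mat_surj_cancel:
  fixes A B :: "'k::field mat"
  assumes Y: "Y \<in> carrier_mat s n" "mat_range Y = carrier_vec s"
    and A: "A \<in> carrier_mat r s" and B: "B \<in> carrier_mat r s" and eq: "A * Y = B * Y"
  shows "A = B"
proof (rule mat_eq_if_mult_vec_eq[OF A B])
  fix w :: "'k vec" assume "w \<in> carrier_vec s"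
  then obtain v where v: "v \<in> carrier_vec n" "w = Y *\<^sub>v v"
    using Y by (auto simp: mat_range_def)
  then show "A *\<^sub>v w = B *\<^sub>v w"
    using assoc_mult_mat_vec[OF A Y(1) v(1)] assoc_mult_mat_vec[OF B Y(1) v(1)] eq by simp
qed

section \<open>Trace of nilpotent matrices\<close>

definition mtrace :: "'k::comm_ring_1 mat \<Rightarrow> 'k" where
  "mtrace A = (\<Sum>i<dim_row A. A $$ (i,i))"

lemma mtrace_comm:
  assumes A: "A \<in> carrier_mat r s" and B: "B \<in> carrier_mat s r"
  shows "mtrace (A * B) = mtrace (B * A)"
proof -
  have "mtrace (A * B) = (\<Sum>i<r. \<Sum>j<s. A $$ (i,j) * B $$ (j,i))"
    using A B by (auto simp: mtrace_def scalar_prod_def atLeast0LessThan intro!: sum.cong)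
  also have "\<dots> = (\<Sum>j<s. \<Sum>i<r. B $$ (j,i) * A $$ (i,j))"
    by (subst sum.swap) (simp add: mult.commute)
  also have "\<dots> = mtrace (B * A)"
    using A B by (auto simp: mtrace_def scalar_prod_def atLeast0LessThan intro!: sum.cong)
  finally show ?thesis .
qed

lemma mtrace_add:
  "A \<in> carrier_mat n n \<Longrightarrow> B \<in> carrier_mat n n \<Longrightarrow> mtrace (A + B) = mtrace A + mtrace B"
  by (auto simp: mtrace_def sum.distrib)

lemma mtrace_minus:
  "A \<in> carrier_mat n n \<Longrightarrow> B \<in> carrier_mat n n \<Longrightarrow> mtrace (A - B) = mtrace A - mtrace B"
  by (auto simp: mtrace_def sum_subtractf)

lemma mtrace_smult: "A \<in> carrier_mat n n \<Longrightarrow> mtrace (c \<cdot>\<^sub>m A) = c * mtrace A"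
  by (auto simp: mtrace_def sum_distrib_left)

lemma pow_mat_intertwine:
  fixes P :: "'k::comm_ring_1 mat"
  assumes P: "P \<in> carrier_mat r s" and A: "A \<in> carrier_mat r r" and B: "B \<in> carrier_mat s s"
    and eq: "A * P = P * B"
  shows "A ^\<^sub>m k * P = P * B ^\<^sub>m k"
proof (induction k)
  case 0
  then show ?case using assms by simp
next
  case (Suc k)
  have Ak: "A ^\<^sub>m k \<in> carrier_mat r r" and Bk: "B ^\<^sub>m k \<in> carrier_mat s s"
    using A B by (auto simp: pow_carrier_mat)
  have "A ^\<^sub>m Suc k * P = A ^\<^sub>m k * (A * P)"
    using assoc_mult_mat[OF Ak A P] by simp
  also have "\<dots> = (A ^\<^sub>m k * P) * B"
    unfolding eq by (rule assoc_mult_mat[OF Ak P B, symmetric])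
  also have "\<dots> = P * B ^\<^sub>m Suc k"
    unfolding Suc using assoc_mult_mat[OF P Bk B] by simp
  finally show ?case .
qed

lemma transpose_pow_mat:
  fixes A :: "'k::comm_ring_1 mat"
  assumes A: "A \<in> carrier_mat n n"
  shows "transpose_mat A ^\<^sub>m k = transpose_mat (A ^\<^sub>m k)"
proof (induction k)
  case 0
  then show ?case using A by simp
next
  case (Suc k)
  have "transpose_mat A ^\<^sub>m Suc k = transpose_mat (A ^\<^sub>m k) * transpose_mat A"
    using Suc by simp
  also have "\<dots> = transpose_mat (A * A ^\<^sub>m k)"
    using A by (intro transpose_mult[symmetric]) auto
  also have "A * A ^\<^sub>m k = A ^\<^sub>m Suc k"
    using pow_mat_intertwine[OF A A A refl, of k] by simp
  finally show ?case .
qed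

lemma one_minus_intertwine:
  fixes P :: "'k::comm_ring_1 mat"
  assumes P: "P \<in> carrier_mat n s" and g: "g \<in> carrier_mat n n" and A: "A \<in> carrier_mat s s"
    and eq: "g * P = P * A"
  shows "(g - 1\<^sub>m n) * P = P * (A - 1\<^sub>m s)"
  using minus_mult_distrib_mat[OF g one_carrier_mat P] mult_minus_distrib_mat[OF P A one_carrier_mat]
    P eq by simp

lemma nilpotent_restrict:
  assumes P: "P \<in> carrier_mat r s" "mat_inj P" and A: "A \<in> carrier_mat r r"
    and B: "B \<in> carrier_mat s s" and eq: "A * P = P * B" and nil: "A ^\<^sub>m k = 0\<^sub>m r r"
  shows "B ^\<^sub>m k = 0\<^sub>m s s"
proof -
  have "P * B ^\<^sub>m k = P * 0\<^sub>m s s"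
    using pow_mat_intertwine[OF P(1) A B eq, of k] nil P by simp
  then show ?thesis
    by (rule mat_inj_cancel[OF P(2,1) pow_carrier_mat[OF B] zero_carrier_mat])
qed

lemma nilpotent_not_surj:
  fixes N :: "'k::field mat"
  assumes N: "N \<in> carrier_mat n n" "N ^\<^sub>m k = 0\<^sub>m n n" and surj: "mat_range N = carrier_vec n"
  shows "n = 0"
proof -
  have "N ^\<^sub>m k = 0\<^sub>m n n \<Longrightarrow> (1\<^sub>m n :: 'k mat) = 0\<^sub>m n n"
  proof (induction k)
    case 0
    then show ?case using N by simp
  next
    case (Suc k)
    have "N ^\<^sub>m k * N = 0\<^sub>m n n * N" using Suc.prems N by simp
    then have "N ^\<^sub>m k = 0\<^sub>m n n"
      using mat_surj_cancel[OF N(1) surj pow_carrier_mat[OF N(1)] zero_carrier_mat] by simp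
    then show ?case by (rule Suc.IH)
  qed
  then have *: "(1\<^sub>m n :: 'k mat) = 0\<^sub>m n n" using N(2) .
  show ?thesis
  proof (rule ccontr)
    assume "n \<noteq> 0"
    then have "(1\<^sub>m n :: 'k mat) $$ (0,0) = 1" "(0\<^sub>m n n :: 'k mat) $$ (0,0) = 0" by auto
    then show False unfolding * by simp
  qed
qed

text \<open>If \<open>N = X Y\<close> with \<open>X\<close> injective then \<open>Y X\<close> is nilpotent too, has the same trace, and is smaller.\<close>

lemma mtrace_nilpotent:
  fixes N :: "'k::field mat"
  assumes "N \<in> carrier_mat n n" "N ^\<^sub>m k = 0\<^sub>m n n"
  shows "mtrace N = 0"
  using assms
proof (induction n arbitrary: N rule: less_induct)
  case (less n)
  obtain s X Y where X: "X \<in> carrier_mat n s" "mat_inj X" and Y: "Y \<in> carrier_mat s n"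
      and N: "N = X * Y" and s: "s \<le> n" "s = n \<longrightarrow> mat_range N = carrier_vec n"
    by (rule rank_factorization[OF less.prems(1)])
  show ?case
  proof (cases "s = n")
    case True
    then have "n = 0" using nilpotent_not_surj[OF less.prems] s by blast
    then show ?thesis using less.prems(1) by (simp add: mtrace_def)
  next
    case False
    have "N * X = X * (Y * X)" unfolding N by (rule assoc_mult_mat[OF X(1) Y X(1)])
    then have "(Y * X) ^\<^sub>m k = 0\<^sub>m s s"
      using nilpotent_restrict[OF X less.prems(1) _ _ less.prems(2)] X Y by auto
    then have "mtrace (Y * X) = 0" using less.IH[of s "Y * X"] False s X Y by auto
    then show ?thesis unfolding N using mtrace_comm[OF X(1) Y] by simp
  qed
qed

section \<open>Kolchin's theorem\<close>

inductive_set mat_span :: "'k::comm_ring_1 mat set \<Rightarrow> 'k mat set" for S where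
  base: "g \<in> S \<Longrightarrow> g \<in> mat_span S"
| add: "A \<in> mat_span S \<Longrightarrow> B \<in> mat_span S \<Longrightarrow> A + B \<in> mat_span S"
| smult: "A \<in> mat_span S \<Longrightarrow> c \<cdot>\<^sub>m A \<in> mat_span S"

locale unipotent_monoid =
  fixes n :: nat and S :: "'k::alg_closed_field mat set"
  assumes S_carrier: "S \<subseteq> carrier_mat n n"
    and S_one: "1\<^sub>m n \<in> S"
    and S_mult: "g \<in> S \<Longrightarrow> h \<in> S \<Longrightarrow> g * h \<in> S"
    and S_unipotent: "unipotent_group n S"
begin

lemma S_mat: "g \<in> S \<Longrightarrow> g \<in> carrier_mat n n"
  using S_carrier by blast

lemma span_carrier: "A \<in> mat_span S \<Longrightarrow> A \<in> carrier_mat n n"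
  by (induction rule: mat_span.induct) (auto simp: S_mat)

lemma span_mult:
  assumes "A \<in> mat_span S" "B \<in> mat_span S"
  shows "A * B \<in> mat_span S"
  using assms(1)
proof induction
  case (base g)
  show ?case using assms(2)
  proof induction
    case (base h)
    then show ?case using \<open>g \<in> S\<close> by (intro mat_span.base S_mult)
  next
    case (add A B)
    then show ?case using \<open>g \<in> S\<close>
      by (subst mult_add_distrib_mat[of g n n _ n]) (auto simp: S_mat span_carrier intro: mat_span.add)
  next
    case (smult A c)
    then show ?case using \<open>g \<in> S\<close>
      by (subst mult_smult_distrib[of g n n _ n]) (auto simp: S_mat span_carrier intro: mat_span.smult)
  qed
next
  case (add A A')
  then show ?case using assms(2)
    by (subst add_mult_distrib_mat[of _ n n _ _ n]) (auto simp: span_carrier intro: mat_span.add)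
next
  case (smult A c)
  then show ?case using assms(2)
    by (subst mult_smult_assoc_mat[of _ n n _ n]) (auto simp: span_carrier intro: mat_span.smult)
qed

lemma span_minus:
  assumes "A \<in> mat_span S" "B \<in> mat_span S"
  shows "A - B \<in> mat_span S"
proof -
  have "A - B = A + (- 1) \<cdot>\<^sub>m B"
    using assms by (intro eq_matI) (auto dest!: span_carrier)
  then show ?thesis using assms by (simp add: mat_span.add mat_span.smult)
qed

lemma mtrace_diff_one:
  assumes "g \<in> S"
  shows "mtrace (g - 1\<^sub>m n) = 0"
proof -
  obtain k where "(g - 1\<^sub>m n) ^\<^sub>m k = 0\<^sub>m n n"
    using assms S_unipotent unfolding unipotent_group_def by blast
  then show ?thesis using S_mat[OF assms] by (intro mtrace_nilpotent[of _ n k]) auto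
qed

lemma mtrace_span:
  assumes g: "g \<in> S" and A: "A \<in> mat_span S"
  shows "mtrace ((g - 1\<^sub>m n) * A) = 0"
  using A
proof induction
  case (base h)
  have "(g - 1\<^sub>m n) * h = (g * h - 1\<^sub>m n) - (h - 1\<^sub>m n)"
    using S_mat[OF g] S_mat[OF base]
    by (subst minus_mult_distrib_mat[of _ n n _ _ n]) (auto intro!: eq_matI)
  moreover have "mtrace (g * h - 1\<^sub>m n) = 0" "mtrace (h - 1\<^sub>m n) = 0"
    using g base by (auto intro: mtrace_diff_one S_mult)
  moreover have "mtrace ((g * h - 1\<^sub>m n) - (h - 1\<^sub>m n)) = mtrace (g * h - 1\<^sub>m n) - mtrace (h - 1\<^sub>m n)"
    by (rule mtrace_minus) auto
  ultimately show ?case by simp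
next
  case (add A B)
  let ?g = "g - 1\<^sub>m n"
  have "A \<in> carrier_mat n n" "B \<in> carrier_mat n n" "?g \<in> carrier_mat n n"
    using add S_mat[OF g] span_carrier by auto
  then have "mtrace (?g * (A + B)) = mtrace (?g * A) + mtrace (?g * B)"
    by (metis mult_add_distrib_mat mtrace_add mult_carrier_mat)
  then show ?case using add by simp
next
  case (smult A c)
  let ?g = "g - 1\<^sub>m n"
  have "A \<in> carrier_mat n n" "?g \<in> carrier_mat n n"
    using smult S_mat[OF g] span_carrier by auto
  then have "mtrace (?g * (c \<cdot>\<^sub>m A)) = c * mtrace (?g * A)"
    by (metis mult_smult_distrib mtrace_smult mult_carrier_mat)
  then show ?case using smult by simp
qed

lemma orbit_subspace:
  assumes u: "u \<in> carrier_vec n"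
  shows "vec_subspace n ((\<lambda>A. A *\<^sub>v u) ` mat_span S)"
  unfolding vec_subspace_def
proof (intro conjI ballI allI)
  show "(\<lambda>A. A *\<^sub>v u) ` mat_span S \<subseteq> carrier_vec n"
    using u by (auto dest!: span_carrier)
  have "0\<^sub>v n = (0 \<cdot>\<^sub>m 1\<^sub>m n) *\<^sub>v u"
    using u by (intro eq_vecI) (auto simp: scalar_prod_def)
  then show "0\<^sub>v n \<in> (\<lambda>A. A *\<^sub>v u) ` mat_span S"
    using S_one by (blast intro: mat_span.base mat_span.smult)
next
  fix v w assume "v \<in> (\<lambda>A. A *\<^sub>v u) ` mat_span S" "w \<in> (\<lambda>A. A *\<^sub>v u) ` mat_span S"
  then obtain A B where AB: "A \<in> mat_span S" "v = A *\<^sub>v u" "B \<in> mat_span S" "w = B *\<^sub>v u"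
    by blast
  then have "v + w = (A + B) *\<^sub>v u"
    using u by (subst add_mult_distrib_mat_vec[of _ n n]) (auto dest: span_carrier)
  then show "v + w \<in> (\<lambda>A. A *\<^sub>v u) ` mat_span S"
    using AB by (blast intro: mat_span.add)
next
  fix c v assume "v \<in> (\<lambda>A. A *\<^sub>v u) ` mat_span S"
  then obtain A where A: "A \<in> mat_span S" "v = A *\<^sub>v u" by blast
  then have "c \<cdot>\<^sub>v v = (c \<cdot>\<^sub>m A) *\<^sub>v u"
    using u by (intro eq_vecI) (auto dest!: span_carrier)
  then show "c \<cdot>\<^sub>v v \<in> (\<lambda>A. A *\<^sub>v u) ` mat_span S"
    using A by (blast intro: mat_span.smult)
qed

lemma restrict:
  assumes P: "P \<in> carrier_mat n s" "mat_inj P"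
  shows "unipotent_monoid s {A \<in> carrier_mat s s. \<exists>g\<in>S. g * P = P * A}"
proof
  show "1\<^sub>m s \<in> {A \<in> carrier_mat s s. \<exists>g\<in>S. g * P = P * A}"
    using P S_one by (auto intro!: bexI[of _ "1\<^sub>m n"])
next
  fix A B assume "A \<in> {A \<in> carrier_mat s s. \<exists>g\<in>S. g * P = P * A}"
    "B \<in> {A \<in> carrier_mat s s. \<exists>g\<in>S. g * P = P * A}"
  then obtain g h where AB: "A \<in> carrier_mat s s" "B \<in> carrier_mat s s" "g \<in> S" "h \<in> S"
      "g * P = P * A" "h * P = P * B"
    by blast
  have "(g * h) * P = g * (h * P)"
    using AB P by (intro assoc_mult_mat[of _ n n _ n _ s]) (auto simp: S_mat)
  also have "\<dots> = (g * P) * B"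
    unfolding AB(6) using AB P by (intro assoc_mult_mat[of _ n n _ s _ s, symmetric]) (auto simp: S_mat)
  also have "\<dots> = P * (A * B)"
    unfolding AB(5) using AB P by (intro assoc_mult_mat[of _ n s _ s _ s]) auto
  finally show "A * B \<in> {A \<in> carrier_mat s s. \<exists>g\<in>S. g * P = P * A}"
    using AB S_mult by auto
next
  show "unipotent_group s {A \<in> carrier_mat s s. \<exists>g\<in>S. g * P = P * A}"
    unfolding unipotent_group_def
  proof
    fix A assume "A \<in> {A \<in> carrier_mat s s. \<exists>g\<in>S. g * P = P * A}"
    then obtain g where A: "A \<in> carrier_mat s s" "g \<in> S" "g * P = P * A" by blast
    obtain k where "(g - 1\<^sub>m n) ^\<^sub>m k = 0\<^sub>m n n"
      using A S_unipotent unfolding unipotent_group_def by blast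
    then have "(A - 1\<^sub>m s) ^\<^sub>m k = 0\<^sub>m s s"
      by (rule nilpotent_restrict[OF P minus_carrier_mat[OF one_carrier_mat]
            minus_carrier_mat[OF one_carrier_mat] one_minus_intertwine[OF P(1) S_mat[OF A(2)] A(1,3)]])
    then show "\<exists>r. (A - 1\<^sub>m s) ^\<^sub>m r = 0\<^sub>m s s" ..
  qed
qed auto

lemma transpose: "unipotent_monoid n (transpose_mat ` S)"
proof
  show "transpose_mat ` S \<subseteq> carrier_mat n n" using S_mat by auto
  show "1\<^sub>m n \<in> transpose_mat ` S" using S_one by (metis image_eqI transpose_one)
next
  fix g h assume "g \<in> transpose_mat ` S" "h \<in> transpose_mat ` S"
  then obtain g' h' where "g' \<in> S" "h' \<in> S" "g = transpose_mat g'" "h = transpose_mat h'" by blast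
  then have "g * h = transpose_mat (h' * g')" "h' * g' \<in> S"
    using transpose_mult[of h' n n g' n] S_mat S_mult by auto
  then show "g * h \<in> transpose_mat ` S" by blast
next
  show "unipotent_group n (transpose_mat ` S)"
    unfolding unipotent_group_def
  proof
    fix h assume "h \<in> transpose_mat ` S"
    then obtain g where g: "g \<in> S" "h = transpose_mat g" by blast
    obtain k where k: "(g - 1\<^sub>m n) ^\<^sub>m k = 0\<^sub>m n n"
      using g S_unipotent unfolding unipotent_group_def by blast
    have gn: "g \<in> carrier_mat n n" using g S_mat by blast
    have "h - 1\<^sub>m n = transpose_mat (g - 1\<^sub>m n)"
      unfolding g using gn by (intro eq_matI) auto
    then have "(h - 1\<^sub>m n) ^\<^sub>m k = 0\<^sub>m n n"
      using k transpose_pow_mat[OF minus_carrier_mat[OF one_carrier_mat], of g n k] by simp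
    then show "\<exists>r. (h - 1\<^sub>m n) ^\<^sub>m r = 0\<^sub>m n n" ..
  qed
qed

end

lemma mat_zero_dims:
  fixes X :: "'k::comm_ring_1 mat"
  assumes "X \<in> carrier_mat n 0" "Y \<in> carrier_mat 0 m"
  shows "X * Y = 0\<^sub>m n m"
  using assms by (intro eq_matI) (auto simp: scalar_prod_def)

lemma eigenvalue_exists:
  fixes M :: "'k::alg_closed_field mat"
  assumes M: "M \<in> carrier_mat s s" and s: "0 < s"
  obtains c v where "v \<in> carrier_vec s" "v \<noteq> 0\<^sub>v s" "M *\<^sub>v v = c \<cdot>\<^sub>v v"
proof -
  have "degree (char_poly M) > 0" using degree_monic_char_poly[OF M] s by simp
  then obtain c where "poly (char_poly M) c = 0" using alg_closed_imp_poly_has_root by blast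
  then have "eigenvalue M c" using eigenvalue_root_char_poly[OF M] by blast
  then show thesis using that M unfolding eigenvalue_def eigenvector_def by auto
qed

lemma singular_not_surj:
  fixes N :: "'k::field mat"
  assumes N: "N \<in> carrier_mat s s" and v: "v \<in> carrier_vec s" "v \<noteq> 0\<^sub>v s" "N *\<^sub>v v = 0\<^sub>v s"
  shows "mat_range N \<noteq> carrier_vec s"
proof
  assume range: "mat_range N = carrier_vec s"
  have "mat_range (1\<^sub>m s :: 'k mat) \<subseteq> mat_range N"
    unfolding range by (auto simp: mat_range_def)
  then obtain B where B: "B \<in> carrier_mat s s" "1\<^sub>m s = N * B"
    using mat_factor_through[OF N one_carrier_mat] by blast
  have "det N = 0" using det_0_iff_vec_prod_zero_field[OF N] v by blast
  then have "det (1\<^sub>m s :: 'k mat) = 0" unfolding B(2) using det_mult[OF N B(1)] by simp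
  then show False by simp
qed

context unipotent_monoid
begin

lemma span_one: "1\<^sub>m n \<in> mat_span S"
  using S_one by (rule mat_span.base)

text \<open>
  A nonzero element \<open>T = X Y\<close> of minimal rank of an algebra of matrices: by minimality
  \<open>T A T - \<lambda> T = X (Y A X - \<lambda>) Y\<close> vanishes whenever \<open>\<lambda>\<close> is an eigenvalue of \<open>Y A X\<close>.
\<close>

lemma minimal_rank_element:
  assumes n: "0 < n"
  obtains s T X Y where "0 < s" "T \<in> mat_span S" "X \<in> carrier_mat n s" "mat_inj X"
    "Y \<in> carrier_mat s n" "mat_range Y = carrier_vec s" "T = X * Y"
    "\<forall>A\<in>mat_span S. \<exists>c. Y * A * X = c \<cdot>\<^sub>m 1\<^sub>m s"
proof -
  define Q where "Q s \<longleftrightarrow> (\<exists>T X Y. T \<in> mat_span S \<and> T \<noteq> 0\<^sub>m n n \<and> X \<in> carrier_mat n s \<and> mat_inj X \<and>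
    Y \<in> carrier_mat s n \<and> mat_range Y = carrier_vec s \<and> T = X * Y)" for s
  have "(1\<^sub>m n :: 'k mat) \<noteq> 0\<^sub>m n n"
  proof
    assume *: "(1\<^sub>m n :: 'k mat) = 0\<^sub>m n n"
    have "(1\<^sub>m n :: 'k mat) $$ (0,0) = 1" "(0\<^sub>m n n :: 'k mat) $$ (0,0) = 0" using n by auto
    then show False unfolding * by simp
  qed
  moreover obtain s0 X0 Y0 where "X0 \<in> carrier_mat n s0" "mat_inj X0" "Y0 \<in> carrier_mat s0 n"
      "mat_range Y0 = carrier_vec s0" "(1\<^sub>m n :: 'k mat) = X0 * Y0"
    by (rule rank_factorization[OF one_carrier_mat[of n]])
  ultimately have "Q s0" unfolding Q_def using span_one by blast
  define s where "s = (LEAST s. Q s)"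
  have "Q s" unfolding s_def using \<open>Q s0\<close> by (rule LeastI)
  then obtain T X Y where T: "T \<in> mat_span S" "T \<noteq> 0\<^sub>m n n" and X: "X \<in> carrier_mat n s" "mat_inj X"
    and Y: "Y \<in> carrier_mat s n" "mat_range Y = carrier_vec s" and TXY: "T = X * Y"
    unfolding Q_def by blast
  have s: "0 < s"
  proof (rule ccontr)
    assume "\<not> 0 < s"
    then have "T = 0\<^sub>m n n" unfolding TXY using X Y by (intro mat_zero_dims) auto
    then show False using T by blast
  qed
  have "\<exists>c. Y * A * X = c \<cdot>\<^sub>m 1\<^sub>m s" if A: "A \<in> mat_span S" for A
  proof -
    have An: "A \<in> carrier_mat n n" using A by (rule span_carrier)
    define M where "M = Y * A * X"
    have M: "M \<in> carrier_mat s s" using X Y An by (simp add: M_def)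
    obtain c v where v: "v \<in> carrier_vec s" "v \<noteq> 0\<^sub>v s" "M *\<^sub>v v = c \<cdot>\<^sub>v v"
      by (rule eigenvalue_exists[OF M s])
    define N where "N = M - c \<cdot>\<^sub>m 1\<^sub>m s"
    have N: "N \<in> carrier_mat s s" by (auto simp: N_def intro!: minus_carrier_mat)
    have "N *\<^sub>v v = 0\<^sub>v s"
      unfolding N_def using v M
      by (subst minus_mult_distrib_mat_vec[of _ s s]) (auto intro!: eq_vecI)
    have XNY: "X * N * Y = T * A * T - c \<cdot>\<^sub>m T"
    proof -
      have "X * N = X * M - c \<cdot>\<^sub>m X"
        unfolding N_def using X M by (subst mult_minus_distrib_mat[of _ n s _ s]) auto
      then have "X * N * Y = X * M * Y - c \<cdot>\<^sub>m T"
        using X M Y by (simp add: minus_mult_distrib_mat[of _ n s _ _ n] mult_smult_assoc_mat[of _ n s _ n] TXY)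
      also have "X * M * Y = T * A * T"
        unfolding M_def TXY using X Y An
        by (simp add: assoc_mult_mat[of _ n s _ n _ n] assoc_mult_mat[of _ n s _ s _ n]
            assoc_mult_mat[of _ s n _ n _ n] assoc_mult_mat[of _ s n _ n _ s] assoc_mult_mat[of _ s n _ s _ n]
            assoc_mult_mat[of _ n n _ n _ n])
      finally show ?thesis .
    qed
    have "N = 0\<^sub>m s s"
    proof (rule ccontr)
      assume N0: "N \<noteq> 0\<^sub>m s s"
      obtain s' Z Y' where Z: "Z \<in> carrier_mat s s'" "mat_inj Z" and Y': "Y' \<in> carrier_mat s' s"
          "mat_range Y' = carrier_vec s'" and NZY: "N = Z * Y'"
          and s': "s' \<le> s" "s' = s \<longrightarrow> mat_range N = carrier_vec s"
        by (rule rank_factorization[OF N])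
      have "s' < s"
        using singular_not_surj[OF N v(1,2) \<open>N *\<^sub>v v = 0\<^sub>v s\<close>] s' by auto
      have "X * N * Y \<in> mat_span S"
        unfolding XNY using T A by (intro span_minus span_mult mat_span.smult)
      moreover have "X * N * Y \<noteq> 0\<^sub>m n n"
      proof
        assume "X * N * Y = 0\<^sub>m n n"
        then have "X * N * Y = 0\<^sub>m n s * Y" using Y by simp
        then have "X * N = 0\<^sub>m n s"
          by (rule mat_surj_cancel[OF Y mult_carrier_mat[OF X(1) N] zero_carrier_mat])
        then have "X * N = X * 0\<^sub>m s s" using X by simp
        then have "N = 0\<^sub>m s s" by (rule mat_inj_cancel[OF X(2,1) N zero_carrier_mat])
        then show False using N0 by blast
      qed
      moreover have "X * N * Y = (X * Z) * (Y' * Y)"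
        unfolding NZY using X Y Z Y'
        by (simp only: assoc_mult_mat[OF X(1) Z(1) Y'(1), symmetric]
            assoc_mult_mat[OF mult_carrier_mat[OF X(1) Z(1)] Y'(1) Y(1)])
      moreover have "mat_inj (X * Z)" by (rule mat_inj_mult[OF X(2,1) Z(2,1)])
      moreover have "mat_range (Y' * Y) = carrier_vec s'" by (rule mat_surj_mult[OF Y Y'])
      ultimately have "Q s'"
        unfolding Q_def using mult_carrier_mat[OF X(1) Z(1)] mult_carrier_mat[OF Y'(1) Y(1)] by blast
      then have "s \<le> s'" unfolding s_def by (rule Least_le)
      then show False using \<open>s' < s\<close> by simp
    qed
    have "M = c \<cdot>\<^sub>m 1\<^sub>m s"
    proof (rule eq_matI)
      fix i j assume "i < dim_row (c \<cdot>\<^sub>m 1\<^sub>m s)" "j < dim_col (c \<cdot>\<^sub>m 1\<^sub>m s)"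
      then have ij: "i < s" "j < s" by auto
      then have "N $$ (i,j) = 0" unfolding \<open>N = 0\<^sub>m s s\<close> by simp
      then show "M $$ (i,j) = (c \<cdot>\<^sub>m 1\<^sub>m s) $$ (i,j)" using ij M by (simp add: N_def)
    qed (use M in auto)
    then show ?thesis unfolding M_def by blast
  qed
  then show thesis using that[OF s T(1) X Y TXY] by blast
qed

lemma irreducible_fixed_vector:
  assumes n: "0 < n"
    and irr: "\<And>u. u \<in> carrier_vec n \<Longrightarrow> u \<noteq> 0\<^sub>v n \<Longrightarrow> (\<lambda>A. A *\<^sub>v u) ` mat_span S = carrier_vec n"
  shows "\<exists>v\<in>carrier_vec n. v \<noteq> 0\<^sub>v n \<and> (\<forall>g\<in>S. g *\<^sub>v v = v)"
proof -
  obtain s T X Y where s: "0 < s" and T: "T \<in> mat_span S" and X: "X \<in> carrier_mat n s" "mat_inj X"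
    and Y: "Y \<in> carrier_mat s n" "mat_range Y = carrier_vec s" and TXY: "T = X * Y"
    and scalar: "\<forall>A\<in>mat_span S. \<exists>c. Y * A * X = c \<cdot>\<^sub>m 1\<^sub>m s"
    by (rule minimal_rank_element[OF n])
  define e where "e = (unit_vec s 0 :: 'k vec)"
  have e: "e \<in> carrier_vec s" "e \<noteq> 0\<^sub>v s" using s by (auto simp: e_def)
  have Xe: "X *\<^sub>v e \<in> carrier_vec n" "X *\<^sub>v e \<noteq> 0\<^sub>v n"
    using X e mat_injD[OF X(2,1)] by auto
  have transitive: "\<exists>A\<in>mat_span S. v = A *\<^sub>v (X *\<^sub>v e)" if "v \<in> carrier_vec n" for v
    using irr[OF Xe] that by auto
  have YAX: "Y *\<^sub>v (A *\<^sub>v (X *\<^sub>v e)) = (Y * A * X) *\<^sub>v e" if "A \<in> carrier_mat n n" for A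
    using that X Y e by (simp add: assoc_mult_mat_vec[of _ s n _ s] assoc_mult_mat_vec[of _ s n _ n])
  have "s = 1"
  proof (rule ccontr)
    assume "s \<noteq> 1"
    then have s1: "1 < s" using s by simp
    then obtain v where v: "v \<in> carrier_vec n" "unit_vec s 1 = Y *\<^sub>v v"
      using Y by (metis (no_types, lifting) carrier_matD(2) imageE mat_range_def unit_vec_carrier)
    obtain A where A: "A \<in> mat_span S" "v = A *\<^sub>v (X *\<^sub>v e)" using transitive v by blast
    obtain c where "Y * A * X = c \<cdot>\<^sub>m 1\<^sub>m s" using scalar A by blast
    then have "unit_vec s 1 = (c \<cdot>\<^sub>m 1\<^sub>m s) *\<^sub>v e"
      using v A YAX[OF span_carrier] by simp
    then have "(unit_vec s 1 :: 'k vec) $ 1 = ((c \<cdot>\<^sub>m 1\<^sub>m s) *\<^sub>v e) $ 1" by simp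
    then show False using s1 by (simp add: e_def)
  qed
  have Y_fixed: "Y * g = Y" if g: "g \<in> S" for g
  proof -
    let ?g = "g - 1\<^sub>m n"
    have gn: "g \<in> carrier_mat n n" "?g \<in> carrier_mat n n" using g by (auto simp: S_mat)
    have "Y *\<^sub>v (?g *\<^sub>v v) = 0\<^sub>v s" if v: "v \<in> carrier_vec n" for v
    proof -
      obtain A where A: "A \<in> mat_span S" "v = A *\<^sub>v (X *\<^sub>v e)" using transitive v by blast
      have An: "A \<in> carrier_mat n n" using A span_carrier by blast
      have *: "Y * (?g * A) * X \<in> carrier_mat 1 1" using Y X An gn \<open>s = 1\<close> by auto
      have "(Y * (?g * A) * X) $$ (0,0) = mtrace (Y * (?g * A) * X)"
        using * by (auto simp: mtrace_def)
      also have "\<dots> = mtrace (Y * ((?g * A) * X))"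
        using Y X An gn by (subst assoc_mult_mat[of _ s n _ n _ s]) auto
      also have "\<dots> = mtrace (((?g * A) * X) * Y)"
        using Y X An gn by (intro mtrace_comm[of _ s n]) auto
      also have "((?g * A) * X) * Y = ?g * (A * T)"
        unfolding TXY using Y X An gn
        by (simp add: assoc_mult_mat[of _ n n _ s _ n] assoc_mult_mat[of _ n n _ n _ n])
      also have "mtrace \<dots> = 0" using g A T by (intro mtrace_span span_mult)
      finally have "Y * (?g * A) * X = 0\<^sub>m s s"
        using * \<open>s = 1\<close> by (intro eq_matI) auto
      then have "Y *\<^sub>v ((?g * A) *\<^sub>v (X *\<^sub>v e)) = 0\<^sub>v s"
        using YAX[of "?g * A"] An gn e by auto
      then show ?thesis using A gn An Xe by (simp add: assoc_mult_mat_vec[of _ n n _ n])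
    qed
    moreover have "(Y * g) *\<^sub>v v = Y *\<^sub>v v + Y *\<^sub>v (?g *\<^sub>v v)" if v: "v \<in> carrier_vec n" for v
    proof -
      have "g *\<^sub>v v = v + ?g *\<^sub>v v"
        using gn v by (subst minus_mult_distrib_mat_vec[of _ n n]) (auto intro!: eq_vecI)
      then show ?thesis
        using gn v Y by (simp add: assoc_mult_mat_vec[of _ s n _ n] mult_add_distrib_mat_vec[of _ s n])
    qed
    ultimately show ?thesis
      using Y gn by (intro mat_eq_if_mult_vec_eq[of _ s n]) auto
  qed
  have Y_span: "\<exists>c. Y * A = c \<cdot>\<^sub>m Y" if "A \<in> mat_span S" for A
    using that
  proof induction
    case (base g)
    then show ?case using Y_fixed by (intro exI[of _ 1]) (auto intro!: eq_matI)
  next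
    case (add A B)
    then obtain c d where cd: "Y * A = c \<cdot>\<^sub>m Y" "Y * B = d \<cdot>\<^sub>m Y" by blast
    have "Y * (A + B) = Y * A + Y * B"
      using add Y by (intro mult_add_distrib_mat[of _ s n _ n]) (auto dest: span_carrier)
    then have "Y * (A + B) = (c + d) \<cdot>\<^sub>m Y"
      using cd by (auto intro!: eq_matI simp: distrib_right)
    then show ?case ..
  next
    case (smult A d)
    then obtain c where c: "Y * A = c \<cdot>\<^sub>m Y" by blast
    have "Y * (d \<cdot>\<^sub>m A) = d \<cdot>\<^sub>m (Y * A)"
      using smult Y by (intro mult_smult_distrib[of _ s n _ n]) (auto dest: span_carrier)
    then have "Y * (d \<cdot>\<^sub>m A) = (d * c) \<cdot>\<^sub>m Y" using c Y by (auto intro!: eq_matI)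
    then show ?case ..
  qed
  have "mat_inj Y"
    unfolding mat_inj_def
  proof (intro ballI impI)
    fix u assume "u \<in> carrier_vec (dim_col Y)" and "Y *\<^sub>v u = 0\<^sub>v (dim_row Y)"
    then have u: "u \<in> carrier_vec n" "Y *\<^sub>v u = 0\<^sub>v s" using Y by auto
    show "u = 0\<^sub>v (dim_col Y)"
    proof (rule ccontr)
      assume "u \<noteq> 0\<^sub>v (dim_col Y)"
      then have u0: "u \<noteq> 0\<^sub>v n" using Y by auto
      obtain v where v: "v \<in> carrier_vec n" "e = Y *\<^sub>v v"
        using Y e by (metis (no_types, lifting) carrier_matD(2) imageE mat_range_def)
      obtain A where A: "A \<in> mat_span S" "v = A *\<^sub>v u" using irr[OF u(1) u0] v by auto
      obtain c where c: "Y * A = c \<cdot>\<^sub>m Y" using Y_span A by blast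
      have "e = (Y * A) *\<^sub>v u"
        using v A u Y span_carrier[OF A(1)] by (simp add: assoc_mult_mat_vec[of _ s n _ n])
      also have "\<dots> = c \<cdot>\<^sub>v (Y *\<^sub>v u)" unfolding c using Y u(1) by (intro eq_vecI) auto
      also have "\<dots> = 0\<^sub>v s" using u by auto
      finally show False using e by blast
    qed
  qed
  have "g *\<^sub>v v = v" if "g \<in> S" "v \<in> carrier_vec n" for g v
  proof -
    have "Y *\<^sub>v (g *\<^sub>v v) = Y *\<^sub>v v"
      using that Y S_mat Y_fixed by (metis assoc_mult_mat_vec)
    then show ?thesis
      using mat_inj_cancel_vec[OF \<open>mat_inj Y\<close> Y(1) mult_mat_vec_carrier[OF S_mat[OF that(1)] that(2)] that(2)]
      by simp
  qed
  then show ?thesis using n by (intro bexI[of _ "unit_vec n 0"]) auto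
qed

end

theorem kolchin_fixed_vector:
  assumes "unipotent_monoid n S" "0 < n"
  shows "\<exists>v\<in>carrier_vec n. v \<noteq> 0\<^sub>v n \<and> (\<forall>g\<in>S. g *\<^sub>v v = v)"
  using assms
proof (induction n arbitrary: S rule: less_induct)
  case (less n)
  interpret unipotent_monoid n S by (rule less.prems)
  let ?orbit = "\<lambda>u. (\<lambda>A. A *\<^sub>v u) ` mat_span S"
  show ?case
  proof (cases "\<forall>u\<in>carrier_vec n. u \<noteq> 0\<^sub>v n \<longrightarrow> ?orbit u = carrier_vec n")
    case True
    then show ?thesis using irreducible_fixed_vector[OF less.prems(2)] by blast
  next
    case False
    then obtain u where u: "u \<in> carrier_vec n" "u \<noteq> 0\<^sub>v n" "?orbit u \<noteq> carrier_vec n" by blast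
    obtain s P where P: "P \<in> carrier_mat n s" "mat_inj P" and orbit: "?orbit u = mat_range P"
        and s: "s \<le> n" "s = n \<longrightarrow> ?orbit u = carrier_vec n"
      by (rule vec_subspace_basis[OF orbit_subspace[OF u(1)]])
    have "s < n" using s u by auto
    have "u \<in> mat_range P"
      unfolding orbit[symmetric] using u span_one by (intro image_eqI[of _ _ "1\<^sub>m n"]) auto
    then obtain w where w: "w \<in> carrier_vec s" "u = P *\<^sub>v w" using P by (auto simp: mat_range_def)
    have "0 < s"
    proof (rule ccontr)
      assume "\<not> 0 < s"
      then have "u = 0\<^sub>v n" using w P by (intro eq_vecI) (auto simp: scalar_prod_def)
      then show False using u by blast
    qed
    let ?S = "{A \<in> carrier_mat s s. \<exists>g\<in>S. g * P = P * A}"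
    obtain x where x: "x \<in> carrier_vec s" "x \<noteq> 0\<^sub>v s" "\<And>A. A \<in> ?S \<Longrightarrow> A *\<^sub>v x = x"
      using less.IH[OF \<open>s < n\<close> restrict[OF P] \<open>0 < s\<close>] by blast
    have "g *\<^sub>v (P *\<^sub>v x) = P *\<^sub>v x" if g: "g \<in> S" for g
    proof -
      have gn: "g \<in> carrier_mat n n" using g by (rule S_mat)
      have "mat_range (g * P) \<subseteq> mat_range P"
      proof
        fix y assume "y \<in> mat_range (g * P)"
        then obtain z where z: "z \<in> carrier_vec s" "y = (g * P) *\<^sub>v z"
          using P by (auto simp: mat_range_def)
        have "P *\<^sub>v z \<in> ?orbit u" unfolding orbit using z P by (auto simp: mat_range_def)
        then obtain A where A: "A \<in> mat_span S" "P *\<^sub>v z = A *\<^sub>v u" by blast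
        have "y = (g * A) *\<^sub>v u"
          using z A gn P u span_carrier[OF A(1)]
          by (simp add: assoc_mult_mat_vec[of _ n n _ s] assoc_mult_mat_vec[of _ n n _ n])
        moreover have "g * A \<in> mat_span S" using span_mult[OF mat_span.base[OF g] A(1)] .
        ultimately show "y \<in> mat_range P" unfolding orbit[symmetric] by blast
      qed
      then obtain A where A: "A \<in> carrier_mat s s" "g * P = P * A"
        using mat_factor_through[OF P(1) mult_carrier_mat[OF gn P(1)]] by blast
      then have "A *\<^sub>v x = x" using x g by blast
      then show ?thesis
        using assoc_mult_mat_vec[OF gn P(1) x(1)] assoc_mult_mat_vec[OF P(1) A(1) x(1)] A(2) by simp
    qed
    moreover have "P *\<^sub>v x \<noteq> 0\<^sub>v n" using mat_injD[OF P(2,1)] x by blast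
    ultimately show ?thesis using P x by (intro bexI[of _ "P *\<^sub>v x"]) auto
  qed
qed

context unipotent_monoid
begin

lemma almost_fixed_vector:
  assumes nontrivial: "g0 \<in> S" "g0 \<noteq> 1\<^sub>m n"
  obtains v g where "v \<in> carrier_vec n" "g \<in> S" "g *\<^sub>v v \<noteq> v"
    "\<forall>g\<in>S. \<forall>h\<in>S. h *\<^sub>v (g *\<^sub>v v - v) = g *\<^sub>v v - v"
proof -
  define Q where "Q s \<longleftrightarrow> (\<exists>P. P \<in> carrier_mat n s \<and> mat_inj P \<and>
    (\<forall>g\<in>S. \<exists>A\<in>carrier_mat s s. g * P = P * A) \<and> (\<exists>g\<in>S. g * P \<noteq> P))" for s
  have "mat_inj (1\<^sub>m n :: 'k mat)" by (auto simp: mat_inj_def)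
  moreover have "\<exists>A\<in>carrier_mat n n. g * 1\<^sub>m n = 1\<^sub>m n * A" if "g \<in> S" for g
    using S_mat[OF that] by (intro bexI[of _ g]) auto
  moreover have "g0 * 1\<^sub>m n \<noteq> 1\<^sub>m n" using nontrivial S_mat[of g0] by simp
  ultimately have "Q n"
    unfolding Q_def using nontrivial(1) one_carrier_mat[of n] by (intro exI[of _ "1\<^sub>m n"] conjI ballI) blast+
  define s where "s = (LEAST s. Q s)"
  have "Q s" unfolding s_def using \<open>Q n\<close> by (rule LeastI)
  then obtain P g1 where P: "P \<in> carrier_mat n s" "mat_inj P"
      and inv: "\<And>g. g \<in> S \<Longrightarrow> \<exists>A\<in>carrier_mat s s. g * P = P * A" and g1: "g1 \<in> S" "g1 * P \<noteq> P"
    unfolding Q_def by blast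
  have "0 < s"
  proof (rule ccontr)
    assume "\<not> 0 < s"
    then have "g1 * P = P" using P S_mat[OF g1(1)] by (intro eq_matI) auto
    then show False using g1 by blast
  qed
  let ?S = "{A \<in> carrier_mat s s. \<exists>g\<in>S. g * P = P * A}"
  interpret R: unipotent_monoid s ?S by (rule restrict[OF P])
  obtain y where y: "y \<in> carrier_vec s" "y \<noteq> 0\<^sub>v s"
      and y_fixed: "\<And>A. A \<in> ?S \<Longrightarrow> transpose_mat A *\<^sub>v y = y"
    using kolchin_fixed_vector[OF R.transpose \<open>0 < s\<close>] by blast
  have y_inv: "y \<bullet> (A *\<^sub>v u) = y \<bullet> u" if "A \<in> ?S" "u \<in> carrier_vec s" for A u
  proof -
    have "y \<bullet> (A *\<^sub>v u) = (transpose_mat A *\<^sub>v y) \<bullet> u"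
      using that y by (subst transpose_vec_mult_scalar[of _ s s]) auto
    then show ?thesis using y_fixed[OF that(1)] by simp
  qed
  define K where "K = {u \<in> carrier_vec s. y \<bullet> u = 0}"
  have "vec_subspace s K"
    unfolding vec_subspace_def K_def using y by (auto simp: scalar_prod_add_distrib[of _ s])
  then obtain s' Z where Z: "Z \<in> carrier_mat s s'" "mat_inj Z" and K: "K = mat_range Z"
      and s': "s' \<le> s" "s' = s \<longrightarrow> K = carrier_vec s"
    by (rule vec_subspace_basis)
  have "K \<noteq> carrier_vec s"
  proof
    assume K_all: "K = carrier_vec s"
    have "y $ i = 0" if "i < s" for i
    proof -
      have "unit_vec s i \<in> K" unfolding K_all by simp
      then show ?thesis using y that by (simp add: K_def)
    qed
    then have "y = 0\<^sub>v s" using y by (intro eq_vecI) auto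
    then show False using y by blast
  qed
  then have "s' < s" using s' by auto
  have PZ: "P * Z \<in> carrier_mat n s'" using P Z by simp
  have "\<exists>B\<in>carrier_mat s' s'. g * (P * Z) = (P * Z) * B" if g: "g \<in> S" for g
  proof -
    obtain A where A: "A \<in> carrier_mat s s" "g * P = P * A" using inv[OF g] by blast
    have "mat_range (A * Z) \<subseteq> mat_range Z"
    proof
      fix x assume "x \<in> mat_range (A * Z)"
      then obtain z where z: "z \<in> carrier_vec s'" "x = (A * Z) *\<^sub>v z"
        using Z by (auto simp: mat_range_def)
      have "Z *\<^sub>v z \<in> K" unfolding K using z Z by (auto simp: mat_range_def)
      then have "A *\<^sub>v (Z *\<^sub>v z) \<in> K" unfolding K_def using y_inv[of A "Z *\<^sub>v z"] A g by auto
      then show "x \<in> mat_range Z" unfolding K[symmetric] using z A Z by simp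
    qed
    then obtain B where B: "B \<in> carrier_mat s' s'" "A * Z = Z * B"
      using mat_factor_through[OF Z(1) mult_carrier_mat[OF A(1) Z(1)]] by blast
    have "g * (P * Z) = (P * A) * Z"
      using assoc_mult_mat[OF S_mat[OF g] P(1) Z(1)] A by simp
    also have "\<dots> = P * (Z * B)"
      using assoc_mult_mat[OF P(1) A(1) Z(1)] B by simp
    also have "\<dots> = (P * Z) * B" using assoc_mult_mat[OF P(1) Z(1) B(1)] by simp
    finally show ?thesis using B by blast
  qed
  moreover have "\<not> Q s'"
    using \<open>s' < s\<close> not_less_Least unfolding s_def by blast
  ultimately have PZ_fixed: "g * (P * Z) = P * Z" if "g \<in> S" for g
    using that PZ mat_inj_mult[OF P(2,1) Z(2,1)] unfolding Q_def by blast
  have K_fixed: "g *\<^sub>v (P *\<^sub>v u) = P *\<^sub>v u" if g: "g \<in> S" and u: "u \<in> K" for g u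
  proof -
    obtain z where z: "z \<in> carrier_vec s'" "u = Z *\<^sub>v z"
      using u Z unfolding K by (auto simp: mat_range_def)
    then have "P *\<^sub>v u = (P * Z) *\<^sub>v z" using P Z by simp
    then show ?thesis
      using assoc_mult_mat_vec[OF S_mat[OF g] PZ z(1)] PZ_fixed[OF g] by simp
  qed
  obtain u where u: "u \<in> carrier_vec s" "(g1 * P) *\<^sub>v u \<noteq> P *\<^sub>v u"
    using mat_eq_if_mult_vec_eq[OF mult_carrier_mat[OF S_mat[OF g1(1)] P(1)] P(1)] g1 by blast
  show thesis
  proof
    show "P *\<^sub>v u \<in> carrier_vec n" using P u by simp
    show "g1 \<in> S" by (rule g1)
    show "g1 *\<^sub>v (P *\<^sub>v u) \<noteq> P *\<^sub>v u"
      using u assoc_mult_mat_vec[OF S_mat[OF g1(1)] P(1) u(1)] by simp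
    show "\<forall>g\<in>S. \<forall>h\<in>S. h *\<^sub>v (g *\<^sub>v (P *\<^sub>v u) - P *\<^sub>v u) = g *\<^sub>v (P *\<^sub>v u) - P *\<^sub>v u"
    proof (intro ballI)
      fix g h assume g: "g \<in> S" and h: "h \<in> S"
      obtain A where A: "A \<in> carrier_mat s s" "g * P = P * A" using inv[OF g] by blast
      have "g *\<^sub>v (P *\<^sub>v u) = P *\<^sub>v (A *\<^sub>v u)"
        using assoc_mult_mat_vec[OF S_mat[OF g] P(1) u(1)] assoc_mult_mat_vec[OF P(1) A(1) u(1)] A by simp
      then have "g *\<^sub>v (P *\<^sub>v u) - P *\<^sub>v u = P *\<^sub>v (A *\<^sub>v u - u)"
        using P A u by (simp add: mult_minus_distrib_mat_vec[of _ n s])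
      moreover have "A *\<^sub>v u - u \<in> K"
        using y_inv[of A u] A g u y by (auto simp: K_def scalar_prod_minus_distrib[of _ s])
      ultimately show "h *\<^sub>v (g *\<^sub>v (P *\<^sub>v u) - P *\<^sub>v u) = g *\<^sub>v (P *\<^sub>v u) - P *\<^sub>v u"
        using K_fixed[OF h] by simp
    qed
  qed
qed

end

section \<open>Invariants of the Frobenius-twisted action of the additive group\<close>

lemma poly_eq_if_infinite:
  fixes p q :: "'k::idom poly"
  assumes "infinite T" "\<And>t. t \<in> T \<Longrightarrow> poly p t = poly q t"
  shows "p = q"
proof (rule ccontr)
  assume "p \<noteq> q"
  then have "finite {x. poly (p - q) x = 0}" by (intro poly_roots_finite) simp
  moreover have "T \<subseteq> {x. poly (p - q) x = 0}" using assms by auto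
  ultimately show False using assms(1) finite_subset by blast
qed

definition psubst :: "('x, 'k::comm_ring_1) mpoly \<Rightarrow> ('x \<Rightarrow> 'k poly) \<Rightarrow> 'k poly" where
  "psubst f \<sigma> = (\<Sum>m\<in>keys f. Polynomial.smult (lookup f m) (\<Prod>x\<in>keys m. \<sigma> x ^ lookup m x))"

lemma poly_psubst: "poly (psubst f \<sigma>) t = meval f (\<lambda>x. poly (\<sigma> x) t)"
  by (simp add: psubst_def meval_def poly_sum poly_prod)

lemma degree_psubst_le:
  fixes \<sigma> :: "'x \<Rightarrow> 'k::idom poly"
  assumes "\<And>x. degree (\<sigma> x) \<le> 1"
  shows "degree (psubst f \<sigma>) \<le> total_deg f"
  unfolding psubst_def
proof (rule degree_sum_le)
  fix m assume m: "m \<in> keys f"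
  have "degree (Polynomial.smult (lookup f m) (\<Prod>x\<in>keys m. \<sigma> x ^ lookup m x))
      \<le> degree (\<Prod>x\<in>keys m. \<sigma> x ^ lookup m x)"
    by (rule degree_smult_le)
  also have "\<dots> \<le> (\<Sum>x\<in>keys m. degree (\<sigma> x ^ lookup m x))"
    using degree_prod_sum_le[of "keys m"] by (simp add: o_def)
  also have "\<dots> \<le> (\<Sum>x\<in>keys m. lookup m x)"
  proof (rule sum_mono)
    fix x
    have "degree (\<sigma> x ^ lookup m x) \<le> degree (\<sigma> x) * lookup m x" by (rule degree_power_le)
    also have "\<dots> \<le> 1 * lookup m x" using assms by (intro mult_right_mono) auto
    finally show "degree (\<sigma> x ^ lookup m x) \<le> lookup m x" by simp
  qed
  also have "\<dots> \<le> total_deg f"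
    unfolding total_deg_def using m by (intro Max_ge) auto
  finally show "degree (Polynomial.smult (lookup f m) (\<Prod>x\<in>keys m. \<sigma> x ^ lookup m x)) \<le> total_deg f" .
qed simp

lemma meval_cong:
  assumes "f \<in> mpolys X" "\<And>x. x \<in> X \<Longrightarrow> a x = b x"
  shows "meval f a = meval f b"
  unfolding meval_def
proof (intro sum.cong refl arg_cong2[of _ _ _ _ "(*)"] prod.cong)
  fix m x assume "m \<in> keys f" "x \<in> keys m"
  then have "x \<in> X" using assms(1) by (auto simp: mpolys_def)
  then show "a x ^ lookup m x = b x ^ lookup m x" using assms(2) by simp
qed

lemma meval_origin: "meval f (\<lambda>_. 0) = const_coeff f"
proof -
  have "(\<Prod>x\<in>keys m. 0 ^ lookup m x) = (if m = 0 then 1 else (0::'a))" for m :: "'b \<Rightarrow>\<^sub>0 nat"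
  proof (cases "m = 0")
    case False
    then obtain x where "x \<in> keys m" by fastforce
    then have "(\<Prod>x\<in>keys m. (0::'a) ^ lookup m x) = 0"
      by (intro prod_zero) (auto simp: in_keys_iff power_0_left intro!: bexI[of _ x])
    then show ?thesis using False by simp
  qed simp
  then have "meval f (\<lambda>_. 0) = (\<Sum>m\<in>keys f. if m = 0 then lookup f m else 0)"
    unfolding meval_def by (intro sum.cong) auto
  then show ?thesis
    by (simp add: const_coeff_def sum.delta in_keys_iff)
qed

lemma monomial_eval_single:
  fixes a :: "'x \<Rightarrow> 'k::comm_ring_1"
  shows "(\<Prod>x\<in>keys (Poly_Mapping.single y e). a x ^ lookup (Poly_Mapping.single y e) x) = a y ^ e"
  by (simp add: lookup_single)

lemma mpolys_add: "p \<in> mpolys X \<Longrightarrow> q \<in> mpolys X \<Longrightarrow> p + q \<in> mpolys X"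
  using Poly_Mapping.keys_add[of p q] by (fastforce simp: mpolys_def)

lemma mpolys_single: "keys m \<subseteq> X \<Longrightarrow> Poly_Mapping.single m c \<in> mpolys X"
  by (auto simp: mpolys_def)

lemma mpolys_zero: "0 \<in> mpolys X"
  by (simp add: mpolys_def)

lemma mpolys_sum: "(\<And>i. i \<in> I \<Longrightarrow> f i \<in> mpolys X) \<Longrightarrow> sum f I \<in> mpolys X"
  by (induction I rule: infinite_finite_induct) (auto intro: mpolys_add mpolys_zero)

lemma mpolys_power: "p \<in> mpolys X \<Longrightarrow> p ^ e \<in> mpolys X"
  by (induction e) (auto intro: mpolys_mult mpolys_one)

lemma meval_power: "meval (p ^ e) a = meval p a ^ e"
  by (induction e) (auto simp: meval_mult)

lemma infinite_UNIV_alg_closed: "infinite (UNIV :: 'k::alg_closed_field set)"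
proof
  assume fin: "finite (UNIV :: 'k set)"
  define p where "p = (\<Prod>a\<in>UNIV. [:- a, 1:]) + (1 :: 'k poly)"
  have root: "poly p x = 1" for x
  proof -
    have "(\<Prod>a\<in>UNIV. x - a) = 0" using fin by (intro prod_zero) auto
    then show ?thesis by (simp add: p_def poly_prod)
  qed
  have "degree p > 0"
  proof (rule ccontr)
    assume "\<not> degree p > 0"
    then obtain c where c: "p = [:c:]" by (metis degree_eq_zeroE neq0_conv)
    then have "p = 1" using root[of 0] by (simp add: one_pCons)
    then have "(\<Prod>a\<in>UNIV. [:- a, 1:]) = (0 :: 'k poly)" by (simp add: p_def)
    then show False using fin by (simp add: prod_zero_iff)
  qed
  then show False using alg_closed_imp_poly_has_root[of p] root by auto
qed

definition coords :: "'a \<Rightarrow> 'a \<Rightarrow> 'a \<Rightarrow> nat \<Rightarrow> 'a" where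
  "coords a z b i = (if i = 0 then a else if i = 1 then z else b)"

lemma poly_coords: "poly (coords p q r i) t = coords (poly p t) (poly q t) (poly r t) i"
  by (simp add: coords_def)

lemma coords_zero: "coords 0 0 0 = (\<lambda>_. 0)"
  by (auto simp: coords_def)

lemma invariant_extend:
  fixes f :: "(nat, 'k::field) mpoly"
  assumes T: "infinite T"
    and inv: "\<And>t a z b. t \<in> T \<Longrightarrow> meval f (coords a (z + t * a) (b + t ^ q * a)) = meval f (coords a z b)"
  shows "meval f (coords a (z + t * a) (b + t ^ q * a)) = meval f (coords a z b)"
proof -
  have eval: "poly (psubst f (coords [:a:] [:z, a:] ([:b:] + monom a q))) t =
      meval f (coords a (z + t * a) (b + t ^ q * a))" for t
    by (simp add: poly_psubst poly_coords poly_monom mult.commute)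
  have "psubst f (coords [:a:] [:z, a:] ([:b:] + monom a q)) = [:meval f (coords a z b):]"
    using T by (rule poly_eq_if_infinite) (simp add: eval inv)
  then show ?thesis using eval[of t] by simp
qed

locale frobenius_invariant =
  fixes q :: nat and f :: "(nat, 'k::alg_closed_field) mpoly"
  assumes invariant: "meval f (coords a (z + t * a) (b + t ^ q * a)) = meval f (coords a z b)"
begin

text \<open>
  For fixed \<open>s \<noteq> 0\<close>, choosing \<open>t = - z / s\<close> shows that \<open>f (s, z, 0)\<close> is a polynomial in \<open>z\<^sup>q\<close>, so it
  does not depend on \<open>z\<close> if the degree of \<open>f\<close> is less than \<open>q\<close>.
\<close>

lemma vanish_low_degree:
  assumes deg: "total_deg f < q"
  shows "meval f (coords 0 z 0) = const_coeff f"
proof -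
  have const: "meval f (coords s z 0) = meval f (coords s 0 0)" if s: "s \<noteq> 0" for s
  proof -
    define p where "p = psubst f (coords [:s:] [:0, 1:] 0)"
    define h where "h = psubst f (coords [:s:] 0 [:0, (- 1 / s) ^ q * s:])"
    have p: "poly p z = meval f (coords s z 0)" for z
      by (simp add: p_def poly_psubst poly_coords)
    have h: "poly h x = meval f (coords s 0 (x * ((- 1 / s) ^ q * s)))" for x
      by (simp add: h_def poly_psubst poly_coords)
    have "poly p z = poly (h \<circ>\<^sub>p monom 1 q) z" for z
    proof -
      have "z ^ q * ((- 1 / s) ^ q * s) = (- z / s) ^ q * s"
        by (simp add: power_divide power_mult_distrib[symmetric] mult.assoc[symmetric])
      then show ?thesis
        using invariant[of s z "- z / s" 0] s by (simp add: p h poly_pcompose poly_monom mult.assoc[symmetric])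
    qed
    then have eq: "p = h \<circ>\<^sub>p monom 1 q"
      by (intro poly_eq_if_infinite[OF infinite_UNIV_alg_closed]) auto
    have "degree p \<le> total_deg f"
      unfolding p_def by (rule degree_psubst_le) (simp add: coords_def)
    moreover have "degree p = degree h * q"
      unfolding eq by (simp add: degree_pcompose degree_monom_eq)
    ultimately have "degree h * q < 1 * q" using deg by linarith
    then have "degree h = 0" unfolding mult_less_cancel2 less_one by simp
    then have "degree p = 0" using \<open>degree p = degree h * q\<close> by simp
    then obtain c where "p = [:c:]" by (rule degree_eq_zeroE)
    then show ?thesis using p[of z] p[of 0] by simp
  qed
  have "psubst f (coords [:0, 1:] [:z:] 0) = psubst f (coords [:0, 1:] 0 0)"
  proof (rule poly_eq_if_infinite)
    show "infinite (UNIV - {0 :: 'k})" using infinite_UNIV_alg_closed by simp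
  qed (simp add: poly_psubst poly_coords const)
  then have "poly (psubst f (coords [:0, 1:] [:z:] 0)) 0 = poly (psubst f (coords [:0, 1:] 0 0)) 0"
    by simp
  then show ?thesis by (simp add: poly_psubst poly_coords coords_zero meval_origin)
qed

text \<open>With \<open>c\<^sup>q = - b\<close>, the points \<open>(w\<^sup>q, 0, b)\<close> and \<open>(w\<^sup>q, c w\<^bsup>q - 1\<^esup>, 0)\<close> lie in the same orbit for \<open>w \<noteq> 0\<close>.\<close>

lemma vanish_last_axis:
  assumes q: "2 \<le> q"
  shows "meval f (coords 0 0 b) = const_coeff f"
proof -
  obtain c where c: "c ^ q = - b" using nth_root_exists[of q "- b"] q by auto
  have "psubst f (coords (monom 1 q) 0 [:b:]) = psubst f (coords (monom 1 q) (monom c (q - 1)) 0)"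
  proof (rule poly_eq_if_infinite)
    show "infinite (UNIV - {0 :: 'k})" using infinite_UNIV_alg_closed by simp
    fix w :: 'k assume "w \<in> UNIV - {0}"
    then have w: "w \<noteq> 0" by simp
    have "c / w * w ^ q = c * w ^ (q - 1)"
      using w q by (cases q) auto
    moreover have "(c / w) ^ q * w ^ q = - b"
      using w c by (simp add: power_divide)
    ultimately show "poly (psubst f (coords (monom 1 q) 0 [:b:])) w =
        poly (psubst f (coords (monom 1 q) (monom c (q - 1)) 0)) w"
      using invariant[of "w ^ q" 0 "c / w" b] by (simp add: poly_psubst poly_coords poly_monom)
  qed
  then have "poly (psubst f (coords (monom 1 q) 0 [:b:])) 0 =
      poly (psubst f (coords (monom 1 q) (monom c (q - 1)) 0)) 0"
    by simp
  then show ?thesis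
    using q by (simp add: poly_psubst poly_coords poly_monom coords_zero meval_origin power_0_left)
qed

end

definition frobenius_form :: "nat \<Rightarrow> (nat, 'k::comm_ring_1) mpoly" where
  "frobenius_form q = Poly_Mapping.single (Poly_Mapping.single 1 q) 1 +
     Poly_Mapping.single (Poly_Mapping.single 0 (q - 1) + Poly_Mapping.single 2 1) (- 1)"

lemma meval_frobenius_form: "meval (frobenius_form q) a = a 1 ^ q - a 0 ^ (q - 1) * a 2"
  unfolding frobenius_form_def meval_add meval_single monomial_eval_add monomial_eval_single by simp

lemma frobenius_form_mpolys: "frobenius_form q \<in> mpolys {..<3}"
  unfolding frobenius_form_def
proof (intro mpolys_add mpolys_single)
  show "keys (Poly_Mapping.single 0 (q - 1) + Poly_Mapping.single 2 1 :: nat \<Rightarrow>\<^sub>0 nat) \<subseteq> {..<3}"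
    using Poly_Mapping.keys_add[of "Poly_Mapping.single 0 (q - 1)" "Poly_Mapping.single (2::nat) (1::nat)"]
    by (auto split: if_splits)
qed auto

lemma const_coeff_frobenius_form: "0 < q \<Longrightarrow> const_coeff (frobenius_form q) = 0"
  by (simp add: meval_origin[symmetric] meval_frobenius_form power_0_left)

definition frobenius_mat :: "nat \<Rightarrow> 'k::comm_ring_1 \<Rightarrow> 'k mat" where
  "frobenius_mat q t = mat 3 3 (\<lambda>(i,j). if i = j then 1 else if (i,j) = (1,0) then t
     else if (i,j) = (2,0) then t ^ q else 0)"

lemma frobenius_mat_carrier [simp]: "frobenius_mat q t \<in> carrier_mat 3 3"
  by (simp add: frobenius_mat_def)

lemma sum_less_3: "(\<Sum>i = 0..<3. f i) = f 0 + f 1 + f (2::nat)" for f :: "nat \<Rightarrow> 'a::comm_monoid_add"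
  by (simp add: eval_nat_numeral add.assoc)

lemma frobenius_mat_mult:
  assumes "(s + t) ^ q = s ^ q + t ^ q"
  shows "frobenius_mat q s * frobenius_mat q t = frobenius_mat q (s + t)"
proof (rule eq_matI)
  fix i j assume "i < dim_row (frobenius_mat q (s + t))" "j < dim_col (frobenius_mat q (s + t))"
  then have "i \<in> {0, 1, 2}" "j \<in> {0, 1, 2}" by (auto simp: frobenius_mat_def)
  then show "(frobenius_mat q s * frobenius_mat q t) $$ (i,j) = frobenius_mat q (s + t) $$ (i,j)"
    using assms by (auto simp: frobenius_mat_def scalar_prod_def sum_less_3)
qed (auto simp: frobenius_mat_def)

lemma frobenius_mat_zero: "0 < q \<Longrightarrow> frobenius_mat q 0 = 1\<^sub>m 3"
  by (intro eq_matI) (auto simp: frobenius_mat_def power_0_left)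

lemma frobenius_mat_vec:
  assumes "v \<in> carrier_vec 3" "i < 3"
  shows "(frobenius_mat q t *\<^sub>v v) $ i = coords (v $ 0) (v $ 1 + t * v $ 0) (v $ 2 + t ^ q * v $ 0) i"
proof -
  have "i \<in> {0, 1, 2}" using assms by auto
  then show ?thesis
    using assms by (auto simp: frobenius_mat_def scalar_prod_def sum_less_3 coords_def)
qed

lemma vec3_coords:
  assumes "v \<in> carrier_vec 3" "i < 3"
  shows "v $ i = coords (v $ 0) (v $ 1) (v $ 2) i"
proof -
  have "i \<in> {0, 1, 2}" using assms by auto
  then show ?thesis by (auto simp: coords_def)
qed

lemma GL_carrier: "carrier (GL n) = Units (ring_mat TYPE('k::field) n ())"
  by (simp add: GL_def units_of_carrier)

lemma GL_mult [simp]: "mult (GL n) = ((*) :: 'k::field mat \<Rightarrow> _)"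
  by (simp add: GL_def units_of_mult ring_mat_def)

lemma GL_one [simp]: "one (GL n) = (1\<^sub>m n :: 'k::field mat)"
  by (simp add: GL_def units_of_one ring_mat_def)

lemma GL_group: "group (GL n :: 'k::field mat monoid)"
proof -
  interpret ring "ring_mat TYPE('k) n ()" by (rule ring_mat)
  show ?thesis unfolding GL_def by (rule units_group)
qed

lemma GL_mat: "g \<in> carrier (GL n) \<Longrightarrow> g \<in> carrier_mat n n"
  unfolding GL_carrier by (auto simp: Units_def ring_mat_def)

lemma regular_function_const: "regular_function n G (\<lambda>_. c)"
  unfolding regular_function_def
  by (intro bexI[of _ "Poly_Mapping.single 0 c"] exI[of _ 0] ballI)
     (auto simp: meval_single intro: mpolys_single)

lemma regular_function_power:
  assumes "regular_function n G \<phi>"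
  shows "regular_function n G (\<lambda>g. \<phi> g ^ e)"
proof -
  obtain p r where p: "p \<in> mpolys ({..<n} \<times> {..<n})" "\<And>g. g \<in> G \<Longrightarrow> \<phi> g = meval p (($$) g) / det g ^ r"
    using assms unfolding regular_function_def by blast
  then show ?thesis
    unfolding regular_function_def
    by (intro bexI[of _ "p ^ e"] exI[of _ "r * e"] ballI)
       (auto simp: meval_power power_divide power_mult mpolys_power)
qed

locale additive_character =
  fixes n :: nat and G :: "'k::alg_closed_field mat set" and \<phi> :: "'k mat \<Rightarrow> 'k" and q :: nat
  assumes subgroup: "subgroup G (GL n)"
    and additive: "\<And>g h. g \<in> G \<Longrightarrow> h \<in> G \<Longrightarrow> \<phi> (g * h) = \<phi> g + \<phi> h"
    and regular: "regular_function n G \<phi>"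
    and infinite_image: "infinite (\<phi> ` G)"
    and frobenius: "\<And>s t :: 'k. (s + t) ^ q = s ^ q + t ^ q"
    and q: "2 \<le> q"
begin

abbreviation \<rho> :: "'k mat \<Rightarrow> 'k mat" where
  "\<rho> g \<equiv> frobenius_mat q (\<phi> g)"

lemma frobenius_mat_GL: "frobenius_mat q t \<in> carrier (GL 3)" for t :: 'k
proof -
  have "frobenius_mat q s * frobenius_mat q (- s) = 1\<^sub>m 3" for s :: 'k
    using frobenius_mat_mult[OF frobenius, of s "- s"] frobenius_mat_zero[of q] q by simp
  from this[of t] this[of "- t"] show ?thesis
    unfolding GL_carrier Units_def
    by (auto simp: ring_mat_def intro!: bexI[of _ "frobenius_mat q (- t)"])
qed

lemma module: "G_module n G 3 \<rho>"
  unfolding G_module_def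
proof (intro conjI allI impI)
  show "\<rho> \<in> hom (GL n\<lparr>carrier := G\<rparr>) (GL 3)"
    by (rule homI) (auto simp: frobenius_mat_GL additive frobenius_mat_mult[OF frobenius])
next
  fix i j :: nat assume "i < 3" "j < 3"
  then have "i \<in> {0, 1, 2}" "j \<in> {0, 1, 2}" by auto
  then show "regular_function n G (\<lambda>g. \<rho> g $$ (i, j))"
    using regular regular_function_power[OF regular, of q]
    by (auto simp: frobenius_mat_def regular_function_const)
qed

lemma invariants_iff:
  "f \<in> invariants n G 3 \<rho> \<longleftrightarrow> f \<in> mpolys {..<3} \<and>
     (\<forall>t\<in>\<phi> ` G. \<forall>a z b. meval f (coords a (z + t * a) (b + t ^ q * a)) = meval f (coords a z b))"
proof -
  interpret GL: group "GL n :: 'k mat monoid" by (rule GL_group)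
  have inv_G: "inv\<^bsub>GL n\<^esub> g \<in> G" "inv\<^bsub>GL n\<^esub> (inv\<^bsub>GL n\<^esub> g) = g" if "g \<in> G" for g
    using that subgroup by (auto simp: subgroup.m_inv_closed subgroup.mem_carrier)
  have inv_image: "(\<lambda>g. inv\<^bsub>GL n\<^esub> g) ` G = G"
    using inv_G by (metis (no_types, lifting) image_eqI image_subsetI subsetI subset_antisym)
  show ?thesis
  proof (cases "f \<in> mpolys {..<3}")
    case True
    have act: "meval f (($) (frobenius_mat q t *\<^sub>v v)) =
        meval f (coords (v $ 0) (v $ 1 + t * v $ 0) (v $ 2 + t ^ q * v $ 0))"
      if "v \<in> carrier_vec 3" for t v
      using that by (intro meval_cong[OF True] frobenius_mat_vec) auto
    have id: "meval f (($) v) = meval f (coords (v $ 0) (v $ 1) (v $ 2))" if "v \<in> carrier_vec 3" for v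
      using that by (intro meval_cong[OF True] vec3_coords) auto
    have vecs: "(\<forall>v\<in>carrier_vec 3.
          meval f (coords (v $ 0) (v $ 1 + t * v $ 0) (v $ 2 + t ^ q * v $ 0)) =
          meval f (coords (v $ 0) (v $ 1) (v $ 2))) \<longleftrightarrow>
        (\<forall>a z b. meval f (coords a (z + t * a) (b + t ^ q * a)) = meval f (coords a z b))" for t
    proof (intro iffI allI)
      fix a z b :: 'k assume *: "\<forall>v\<in>carrier_vec 3.
        meval f (coords (v $ 0) (v $ 1 + t * v $ 0) (v $ 2 + t ^ q * v $ 0)) =
        meval f (coords (v $ 0) (v $ 1) (v $ 2))"
      have "vec 3 (coords a z b) \<in> carrier_vec 3" by simp
      from bspec[OF * this]
      show "meval f (coords a (z + t * a) (b + t ^ q * a)) = meval f (coords a z b)"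
        by (simp add: coords_def)
    qed simp
    have "f \<in> invariants n G 3 \<rho> \<longleftrightarrow> (\<forall>g\<in>(\<lambda>g. inv\<^bsub>GL n\<^esub> g) ` G. \<forall>v\<in>carrier_vec 3.
        meval f (($) (\<rho> g *\<^sub>v v)) = meval f (($) v))"
      using True unfolding invariants_def by simp
    also have "\<dots> \<longleftrightarrow> (\<forall>t\<in>\<phi> ` G. \<forall>v\<in>carrier_vec 3.
        meval f (coords (v $ 0) (v $ 1 + t * v $ 0) (v $ 2 + t ^ q * v $ 0)) =
        meval f (coords (v $ 0) (v $ 1) (v $ 2)))"
      unfolding inv_image by (simp add: act id)
    finally show ?thesis
      unfolding vecs using True by blast
  qed (simp add: invariants_def)
qed

lemma invariant_frobenius:
  assumes "f \<in> invariants n G 3 \<rho>"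
  shows "frobenius_invariant q f"
proof
  fix a z t b :: 'k
  show "meval f (coords a (z + t * a) (b + t ^ q * a)) = meval f (coords a z b)"
  proof (rule invariant_extend[OF infinite_image])
    fix t' a' z' b' assume "t' \<in> \<phi> ` G"
    then show "meval f (coords a' (z' + t' * a') (b' + t' ^ q * a')) = meval f (coords a' z' b')"
      using assms unfolding invariants_iff by blast
  qed
qed

lemma frobenius_form_invariant: "frobenius_form q \<in> invariants n G 3 \<rho>"
proof -
  have "(z + t * a) ^ q - a ^ (q - 1) * (b + t ^ q * a) = z ^ q - a ^ (q - 1) * b" for a z b t :: 'k
  proof -
    have "a ^ (q - 1) * a = a ^ q" using q by (cases q) auto
    then show ?thesis by (simp add: frobenius power_mult_distrib algebra_simps)
  qed
  then show ?thesis
    unfolding invariants_iff meval_frobenius_form by (simp add: coords_def frobenius_form_mpolys)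
qed

lemma fixed_points_iff: "v \<in> fixed_points G 3 \<rho> \<longleftrightarrow> v \<in> carrier_vec 3 \<and> v $ 0 = 0"
proof
  assume v: "v \<in> fixed_points G 3 \<rho>"
  have "infinite (\<phi> ` G - {0})" using infinite_image by simp
  then obtain t where "t \<in> \<phi> ` G - {0}" by (metis finite.emptyI equals0I)
  then obtain g where g: "g \<in> G" "\<phi> g \<noteq> 0" by blast
  have v3: "v \<in> carrier_vec 3" and eq: "\<rho> g *\<^sub>v v = v" using v g by (auto simp: fixed_points_def)
  have "v $ 1 = v $ 1 + \<phi> g * v $ 0"
    using frobenius_mat_vec[OF v3, of 1 q "\<phi> g"] unfolding eq by (simp add: coords_def)
  then show "v \<in> carrier_vec 3 \<and> v $ 0 = 0" using g v3 by simp
next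
  assume v: "v \<in> carrier_vec 3 \<and> v $ 0 = 0"
  have "frobenius_mat q t *\<^sub>v v = v" for t :: 'k
  proof (rule eq_vecI)
    fix i assume "i < dim_vec v"
    then have i: "i < 3" using v by auto
    then show "(frobenius_mat q t *\<^sub>v v) $ i = v $ i"
      using frobenius_mat_vec[of v i q t] vec3_coords[of v i] v by simp
  qed (use v in \<open>auto simp: frobenius_mat_def\<close>)
  then show "v \<in> fixed_points G 3 \<rho>" using v by (simp add: fixed_points_def)
qed

lemma meval_fixed_point:
  assumes f: "f \<in> invariants n G 3 \<rho>" and v: "v \<in> fixed_points G 3 \<rho>"
  shows "meval f (($) v) = meval f (coords 0 (v $ 1) (v $ 2))"
proof (rule meval_cong)
  show "f \<in> mpolys {..<3}" using f invariants_iff by blast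
  show "v $ i = coords 0 (v $ 1) (v $ 2) i" if "i \<in> {..<3}" for i
    using vec3_coords[of v i] v that fixed_points_iff by simp
qed

lemma delta_set_total_deg:
  "delta_set n G 3 \<rho> (invariants_upto n G 3 \<rho> (total_deg (frobenius_form q :: (nat, 'k) mpoly)))"
  (is "delta_set n G 3 \<rho> ?S")
  unfolding delta_set_def
proof (intro conjI ballI)
  show "?S \<subseteq> invariants n G 3 \<rho>" by (auto simp: invariants_upto_def)
next
  fix v assume v: "v \<in> fixed_points G 3 \<rho> - nullcone n G 3 \<rho>"
  then have v3: "v \<in> carrier_vec 3" using fixed_points_iff by blast
  have F: "frobenius_form q \<in> plus_part ?S"
    using frobenius_form_invariant const_coeff_frobenius_form[of q] q
    by (auto simp: plus_part_def invariants_upto_def)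
  have "v $ 1 \<noteq> 0"
  proof
    assume v1: "v $ 1 = 0"
    have "meval f (($) v) = 0" if f: "f \<in> plus_part (invariants n G 3 \<rho>)" for f
    proof -
      have f': "f \<in> invariants n G 3 \<rho>" "const_coeff f = 0" using f by (auto simp: plus_part_def)
      interpret frobenius_invariant q f by (rule invariant_frobenius[OF f'(1)])
      show ?thesis
        using meval_fixed_point[OF f'(1)] v v1 vanish_last_axis[OF q] f' by simp
    qed
    then have "v \<in> nullcone n G 3 \<rho>" using v3 by (simp add: nullcone_def)
    then show False using v by blast
  qed
  moreover have "meval (frobenius_form q) (($) v) = (v $ 1) ^ q"
    using v q unfolding meval_frobenius_form by (auto simp: fixed_points_iff power_0_left)
  ultimately show "\<exists>f\<in>plus_part ?S. meval f (($) v) \<noteq> 0" using F by (intro bexI) auto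
qed

lemma delta_set_degree:
  assumes d: "delta_set n G 3 \<rho> (invariants_upto n G 3 \<rho> d)"
  shows "q \<le> d"
proof (rule ccontr)
  assume "\<not> q \<le> d"
  define v where "v = vec 3 (coords 0 (1::'k) 0)"
  have v: "v \<in> fixed_points G 3 \<rho>" by (simp add: fixed_points_iff v_def coords_def)
  have v12: "v $ 1 = 1" "v $ 2 = 0" by (simp_all add: v_def coords_def)
  have "frobenius_form q \<in> plus_part (invariants n G 3 \<rho>)"
    using frobenius_form_invariant const_coeff_frobenius_form[of q] q by (auto simp: plus_part_def)
  moreover have "meval (frobenius_form q) (($) v) \<noteq> 0"
    using v q v12 unfolding meval_frobenius_form by (auto simp: fixed_points_iff power_0_left)
  ultimately have "v \<notin> nullcone n G 3 \<rho>" by (auto simp: nullcone_def)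
  then obtain f where f: "f \<in> plus_part (invariants_upto n G 3 \<rho> d)" "meval f (($) v) \<noteq> 0"
    using d v unfolding delta_set_def by blast
  then have f': "f \<in> invariants n G 3 \<rho>" "total_deg f < q" "const_coeff f = 0"
    using \<open>\<not> q \<le> d\<close> by (auto simp: plus_part_def invariants_upto_def)
  interpret frobenius_invariant q f by (rule invariant_frobenius[OF f'(1)])
  show False
    using f(2) meval_fixed_point[OF f'(1) v] vanish_low_degree[OF f'(2)] f'(3) v12 by simp
qed

lemma delta_group_ge: "enat q \<le> delta_group n G"
proof -
  have "q \<le> delta_module n G 3 \<rho>"
    unfolding delta_module_def by (rule delta_set_degree, rule LeastI, rule delta_set_total_deg)
  also have "enat (delta_module n G 3 \<rho>) \<le> delta_group n G"
    unfolding delta_group_def using module by (intro Sup_upper) blast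
  finally show ?thesis by simp
qed

end

section \<open>An additive character of a unipotent group\<close>

lemma unipotent_monoid_of_group:
  assumes G: "subgroup G (GL n)" and "unipotent_group n G"
  shows "unipotent_monoid n (G :: 'k::alg_closed_field mat set)"
proof
  show "G \<subseteq> carrier_mat n n" using subgroup.subset[OF G] GL_mat by blast
  show "1\<^sub>m n \<in> G" using subgroup.one_closed[OF G] by simp
  show "g * h \<in> G" if "g \<in> G" "h \<in> G" for g h using subgroup.m_closed[OF G that] by simp
qed (rule assms)

text \<open>
  \<open>\<phi> g\<close> is the \<open>i\<close>-th entry of \<open>g v - v\<close>; all \<open>g v - v\<close> are fixed by \<open>G\<close>, hence
  \<open>g h v - v = g (h v - v) + (g v - v) = (h v - v) + (g v - v)\<close>.
\<close>

lemma additive_character_exists: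
  fixes G :: "'k::alg_closed_field mat set"
  assumes subgroup: "subgroup G (GL n)" and unip: "unipotent_group n G"
    and g0: "g0 \<in> G" "g0 \<noteq> 1\<^sub>m n"
  obtains p g where "p \<in> mpolys ({..<n} \<times> {..<n})" "g \<in> G" "meval p (($$) g) \<noteq> 0"
    "\<And>g h. g \<in> G \<Longrightarrow> h \<in> G \<Longrightarrow> meval p (($$) (g * h)) = meval p (($$) g) + meval p (($$) h)"
proof -
  interpret unipotent_monoid n G by (rule unipotent_monoid_of_group[OF subgroup unip])
  obtain v g where v: "v \<in> carrier_vec n" and g: "g \<in> G" "g *\<^sub>v v \<noteq> v"
    and fixed: "\<forall>g\<in>G. \<forall>h\<in>G. h *\<^sub>v (g *\<^sub>v v - v) = g *\<^sub>v v - v"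
    by (rule almost_fixed_vector[OF g0])
  obtain i where i: "i < n" "(g *\<^sub>v v) $ i \<noteq> v $ i"
    using g v S_mat[OF g(1)] by (metis carrier_matD(1) carrier_vecD dim_mult_mat_vec eq_vecI)
  define p :: "(nat \<times> nat, 'k) mpoly" where "p = (\<Sum>j<n. Poly_Mapping.single (Poly_Mapping.single (i,j) 1) (v $ j)) +
    Poly_Mapping.single 0 (- (v $ i))"
  have p: "p \<in> mpolys ({..<n} \<times> {..<n})"
    unfolding p_def using i by (intro mpolys_add mpolys_sum mpolys_single) auto
  have eval: "meval p (($$) g) = (g *\<^sub>v v - v) $ i" if "g \<in> G" for g
  proof -
    have "meval p (($$) g) = (\<Sum>j<n. v $ j * g $$ (i,j)) - v $ i"
      unfolding p_def meval_add meval_sum meval_single monomial_eval_single by simp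
    then show ?thesis
      using S_mat[OF that] v i by (simp add: scalar_prod_def atLeast0LessThan mult.commute)
  qed
  show thesis
  proof
    show "meval p (($$) g) \<noteq> 0" using eval[OF g(1)] i v by simp
  next
    fix g h assume g: "g \<in> G" and h: "h \<in> G"
    have gh: "g \<in> carrier_mat n n" "h \<in> carrier_mat n n" using g h S_mat by auto
    have "(g * h) *\<^sub>v v - v = g *\<^sub>v (h *\<^sub>v v - v) + (g *\<^sub>v v - v)"
      using gh v by (subst mult_minus_distrib_mat_vec[of _ n n]) (auto intro!: eq_vecI simp: assoc_mult_mat_vec[of _ n n _ n])
    then have "(g * h) *\<^sub>v v - v = (h *\<^sub>v v - v) + (g *\<^sub>v v - v)" using fixed g h by simp
    then have "((g * h) *\<^sub>v v - v) $ i = (h *\<^sub>v v - v) $ i + (g *\<^sub>v v - v) $ i"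
      using gh v i by simp
    then show "meval p (($$) (g * h)) = meval p (($$) g) + meval p (($$) h)"
      using eval g h S_mult by simp
  qed (use p g in auto)
qed

lemma connected_finite_image:
  assumes G: "connectedin (zariski_GL n) G" and p: "p \<in> mpolys ({..<n} \<times> {..<n})"
    and fin: "finite ((\<lambda>g. meval p (($$) g)) ` G)" and gh: "g \<in> G" "h \<in> G"
  shows "meval p (($$) g) = meval p (($$) h)"
proof (rule ccontr)
  let ?p = "\<lambda>g. meval p (($$) g)"
  assume ne: "?p g \<noteq> ?p h"
  have sub: "G \<subseteq> carrier (GL n)"
    using connectedin_subset_topspace[OF G] by (simp add: topspace_zariski_GL)
  define C where "C c = {x \<in> carrier (GL n). ?p x = c}" for c
  have closed: "closedin (zariski_GL n) (C c)" for c
    unfolding closedin_zariski_GL C_def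
    by (rule exI[of _ "{p + Poly_Mapping.single 0 (- c)}"])
       (use p in \<open>auto simp: meval_add meval_single intro!: mpolys_add mpolys_single\<close>)
  define D where "D = (\<Union>c\<in>?p ` G - {?p g}. C c)"
  have "closedin (zariski_GL n) D"
    unfolding D_def using fin closed by (intro closedin_Union) auto
  moreover have "G \<subseteq> C (?p g) \<union> D" unfolding D_def C_def using sub by auto
  moreover have "C (?p g) \<inter> D \<inter> G = {}" unfolding D_def C_def by auto
  moreover have "C (?p g) \<inter> G \<noteq> {}" unfolding C_def using gh sub by auto
  moreover have "h \<in> D" unfolding D_def C_def using gh sub ne by (intro UN_I[of "?p h"]) auto
  ultimately show False using gh(2) G closed[of "?p g"] unfolding connectedin_closedin by blast
qed

theorem corollary3p7:
  fixes n :: nat and G :: "'k::alg_closed_field mat set"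
  assumes "CHAR('k) > 0"
    and "linear_algebraic_group n G"
    and "infinite G"
    and "connectedin (zariski_GL n) G"
    and "unipotent_group n G"
  shows "delta_group n G = \<infinity>"
proof -
  have subgroup: "subgroup G (GL n)" using assms(2) by (simp add: linear_algebraic_group_def)
  have "infinite (G - {1\<^sub>m n})" using assms(3) by simp
  then obtain g0 where "g0 \<in> G - {1\<^sub>m n}" by (metis finite.emptyI equals0I)
  then have g0: "g0 \<in> G" "g0 \<noteq> 1\<^sub>m n" by auto
  obtain p g where p: "p \<in> mpolys ({..<n} \<times> {..<n})" and g: "g \<in> G" "meval p (($$) g) \<noteq> 0"
    and add: "\<And>g h. g \<in> G \<Longrightarrow> h \<in> G \<Longrightarrow> meval p (($$) (g * h)) = meval p (($$) g) + meval p (($$) h)"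
    by (rule additive_character_exists[OF subgroup assms(5) g0]) blast
  let ?\<phi> = "\<lambda>g. meval p (($$) g)"
  have one: "1\<^sub>m n \<in> G" using subgroup.one_closed[OF subgroup] by simp
  have "?\<phi> (1\<^sub>m n) = 0" using add[OF one one]
    unfolding left_mult_one_mat[OF one_carrier_mat] by (simp only: add_cancel_right_right)
  then have inf: "infinite (?\<phi> ` G)"
    using connected_finite_image[OF assms(4) p _ g(1) one] g(2) by auto
  have reg: "regular_function n G ?\<phi>"
    unfolding regular_function_def using p by (intro bexI[of _ p] exI[of _ 0]) auto
  have prime: "prime CHAR('k)" using assms(1) by (rule prime_CHAR_semidom)
  have "enat m \<le> delta_group n G" for m
  proof -
    define q where "q = CHAR('k) ^ Suc m"
    have two: "2 \<le> CHAR('k)" using prime by (rule prime_ge_2_nat)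
    have "Suc m < q" unfolding q_def using two by (intro less_le_trans[OF less_exp power_mono]) auto
    have "additive_character n G ?\<phi> q"
    proof (rule additive_character.intro[OF subgroup add reg inf])
      show "(s + t) ^ q = s ^ q + t ^ q" for s t :: 'k
        by (rule freshmans_dream'[OF prime q_def])
      show "2 \<le> q" using \<open>Suc m < q\<close> by simp
    qed
    then have "enat q \<le> delta_group n G" by (rule additive_character.delta_group_ge)
    moreover have "enat m \<le> enat q" using \<open>Suc m < q\<close> by simp
    ultimately show ?thesis by (rule order_trans[rotated])
  qed
  then show ?thesis by (metis enat_ord_simps(1) not_infinity_eq Suc_n_not_le_n)
qed

end
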